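(* Let $\mathcal K_{\mathbb B^4}(q,r)$ be the slice Bergman kernel of the second kind of the unit ball $\mathbb B^4=\{q\in\mathbb H:|q|<1\}$ and let $\Delta$ be the Laplace operator on $\mathbb H\cong\mathbb R^4$ acting in the variable $q$. Then for $q,r\in\mathbb B^4$ $$\Delta\mathcal K_{\mathbb B^4}(q,r)=-\frac4\pi\Big[(1-2\,\mathrm{Re}[q]\,\bar r+|q|^2\bar r^2)^{-2}+2\,(1-2\bar q\,\bar r+\bar q^2\bar r^2)\,(1-2\,\mathrm{Re}[q]\,\bar r+|q|^2\bar r^2)^{-3}\Big]\,\bar r^2.$$
   Context: $\mathbb H$ is the algebra of real quaternions, $\mathbb S^2$ is the set of purely imaginary quaternions of modulus $1$, and for $\mathbf i\in\mathbb S^2$, $\mathbb C(\mathbf i)=\{x+y\mathbf i: x,y\in\mathbb R\}$. For $\Omega\subseteq\mathbb H$ put $\Omega_{\mathbf i}=\Omega\cap\mathbb C(\mathbf i)$. For $q=x_0+\imath x_1+\jmath x_2+kx_3$, $\Delta=\sum_{l=0}^3\partial_{x_l}^2$. $\mathcal{SR}(\Omega)$ is the set of (left) slice regular functions on the open set $\Omega$: real differentiable $f:\Omega\to\mathbb H$ such that for every $\mathbf i\in\mathbb S^2$, $\left(\frac{\partial}{\partial x}+\mathbf i\frac{\partial}{\partial y}\right)f|_{\Omega_{\mathbf i}}(x+y\mathbf i)=0$ on $\Omega_{\mathbf i}$. Let $\Omega=\mathbb B^4$. For $\mathbf j\in\mathbb S^2$, $\mathcal A(\Omega_{\mathbf j})=\{f\in\mathcal{SR}(\Omega):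 \int_{\Omega_{\mathbf j}}|f|^2d\sigma_{\mathbf j}<\infty\}$, with $d\sigma_{\mathbf j}(x+\mathbf j y)=dx\,dy$, is a quaternionic right Hilbert space with inner product $\langle f,g\rangle=\int_{\Omega_{\mathbf j}}\overline f\,g\,d\sigma_{\mathbf j}$. For $q\in\Omega_{\mathbf j}$ there is a unique $K_q(\mathbf j)\in\mathcal A(\Omega_{\mathbf j})$ with $f(q)=\langle K_q(\mathbf j),f\rangle$ for all $f\in\mathcal A(\Omega_{\mathbf j})$. Put $\mathcal K_{\Omega_{\mathbf j}}(q,r)=\overline{K_q(\mathbf j)(r)}$, $q,r\in\Omega_{\mathbf j}$. The slice Bergman kernel of the second kind $\mathcal K_\Omega:\Omega\times\Omega\to\mathbb H$ is the extension in the first variable: for $r\in\Omega$, choose $\mathbf j\in\mathbb S^2$ with $r\in\Omega_{\mathbf j}$, and for $q=x+y\mathbf i\in\Omega$ ($x,y\in\mathbb R$, $\mathbf i\in\mathbb S^2$) put $$\mathcal K_\Omega(x+y\mathbf i,r)=\tfrac12(1-\mathbf i\mathbf j)\,\mathcal K_{\Omega_{\mathbf j}}(x+y\mathbf j,r)+\tfrac12(1+\mathbf i\mathbf j)\,\mathcal K_{\Omega_{\mathbf j}}(x-y\mathbf j,r).$$ *)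

theory Defs
  imports "HOL-Analysis.Analysis"
begin

section \<open>The real quaternions\<close>

codatatype quat = Quat (qRe: real) (qIm1: real) (qIm2: real) (qIm3: real)

lemma quat_eq_iff:
  "p = q \<longleftrightarrow> qRe p = qRe q \<and> qIm1 p = qIm1 q \<and> qIm2 p = qIm2 q \<and> qIm3 p = qIm3 q"
  by (auto intro: quat.expand)

instantiation quat :: ab_group_add
begin

primcorec zero_quat where
  "qRe 0 = 0" | "qIm1 0 = 0" | "qIm2 0 = 0" | "qIm3 0 = 0"

primcorec plus_quat where
  "qRe (p + q) = qRe p + qRe q"
| "qIm1 (p + q) = qIm1 p + qIm1 q"
| "qIm2 (p + q) = qIm2 p + qIm2 q"
| "qIm3 (p + q) = qIm3 p + qIm3 q"

primcorec uminus_quat where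
  "qRe (- p) = - qRe p"
| "qIm1 (- p) = - qIm1 p"
| "qIm2 (- p) = - qIm2 p"
| "qIm3 (- p) = - qIm3 p"

primcorec minus_quat where
  "qRe (p - q) = qRe p - qRe q"
| "qIm1 (p - q) = qIm1 p - qIm1 q"
| "qIm2 (p - q) = qIm2 p - qIm2 q"
| "qIm3 (p - q) = qIm3 p - qIm3 q"

instance
  by standard (simp_all add: quat_eq_iff)

end

instantiation quat :: ring_1
begin

primcorec one_quat where
  "qRe 1 = 1" | "qIm1 1 = 0" | "qIm2 1 = 0" | "qIm3 1 = 0"

primcorec times_quat where
  "qRe (p * q) = qRe p * qRe q - qIm1 p * qIm1 q - qIm2 p * qIm2 q - qIm3 p * qIm3 q"
| "qIm1 (p * q) = qRe p * qIm1 q + qIm1 p * qRe q + qIm2 p * qIm3 q - qIm3 p * qIm2 q"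
| "qIm2 (p * q) = qRe p * qIm2 q - qIm1 p * qIm3 q + qIm2 p * qRe q + qIm3 p * qIm1 q"
| "qIm3 (p * q) = qRe p * qIm3 q + qIm1 p * qIm2 q - qIm2 p * qIm1 q + qIm3 p * qRe q"

instance
  by standard (simp_all add: quat_eq_iff algebra_simps)

end

instantiation quat :: real_algebra_1
begin

primcorec scaleR_quat where
  "qRe (scaleR a p) = a * qRe p"
| "qIm1 (scaleR a p) = a * qIm1 p"
| "qIm2 (scaleR a p) = a * qIm2 p"
| "qIm3 (scaleR a p) = a * qIm3 p"

instance
  by standard (simp_all add: quat_eq_iff algebra_simps)

end

primcorec qcnj :: "quat \<Rightarrow> quat" where
  "qRe (qcnj p) = qRe p"
| "qIm1 (qcnj p) = - qIm1 p"
| "qIm2 (qcnj p) = - qIm2 p"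
| "qIm3 (qcnj p) = - qIm3 p"

lemma quat_sum_squares_eq_0_iff:
  "qRe p * qRe p + qIm1 p * qIm1 p + qIm2 p * qIm2 p + qIm3 p * qIm3 p = 0 \<longleftrightarrow> p = 0"
  by (auto simp: quat_eq_iff add_nonneg_eq_0_iff)

instantiation quat :: real_div_algebra
begin

definition
  "inverse p =
     inverse (qRe p * qRe p + qIm1 p * qIm1 p + qIm2 p * qIm2 p + qIm3 p * qIm3 p) *\<^sub>R qcnj p"

definition "p div q = p * inverse q" for p q :: quat

instance
proof
  fix p q :: quat
  let ?s = "qRe p * qRe p + qIm1 p * qIm1 p + qIm2 p * qIm2 p + qIm3 p * qIm3 p"
  have s: "qcnj p * p = ?s *\<^sub>R 1" "p * qcnj p = ?s *\<^sub>R 1"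
    by (simp_all add: quat_eq_iff)
  show "inverse p * p = 1" "p * inverse p = 1" if "p \<noteq> 0"
    using that quat_sum_squares_eq_0_iff[of p]
    by (simp_all only: inverse_quat_def mult_scaleR_left mult_scaleR_right s scaleR_scaleR)
       (simp_all)
  show "p div q = p * inverse q"
    by (rule divide_quat_def)
  show "inverse (0 :: quat) = 0"
    by (simp add: inverse_quat_def)
qed

end

instantiation quat :: real_inner
begin

definition "inner p q = qRe p * qRe q + qIm1 p * qIm1 q + qIm2 p * qIm2 q + qIm3 p * qIm3 q"

definition "norm p = sqrt (inner p p)" for p :: quat

definition "sgn p = p /\<^sub>R norm p" for p :: quat

definition "dist p q = norm (p - q)" for p q :: quat

definition uniformity_quat_def:
  "(uniformity :: (quat \<times> quat) filter) = (INF e\<in>{0 <..}. principal {(p, q). dist p q < e})"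

definition open_quat_def:
  "open (U :: quat set) \<longleftrightarrow> (\<forall>p\<in>U. eventually (\<lambda>(p', q). p' = p \<longrightarrow> q \<in> U) uniformity)"

instance
proof
  fix p q r :: quat and a :: real
  show "inner p q = inner q p" "inner (p + q) r = inner p r + inner q r"
    "inner (a *\<^sub>R p) q = a * inner p q" "0 \<le> inner p p"
    by (simp_all add: inner_quat_def algebra_simps)
  show "inner p p = 0 \<longleftrightarrow> p = 0"
    by (simp add: inner_quat_def quat_sum_squares_eq_0_iff)
qed (rule norm_quat_def sgn_quat_def dist_quat_def uniformity_quat_def open_quat_def)+

end

instance quat :: real_normed_div_algebra
proof
  fix p q :: quat
  have "inner (p * q) (p * q) = inner p p * inner q q"
    unfolding inner_quat_def times_quat.sel by algebra
  then show "norm (p * q) = norm p * norm q"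
    by (simp add: norm_quat_def real_sqrt_mult)
qed

instantiation quat :: euclidean_space
begin

definition
  "Basis = {Quat 1 0 0 0, Quat 0 1 0 0, Quat 0 0 1 0, Quat 0 0 0 1}"

instance
proof
  show "(Basis :: quat set) \<noteq> {}" "finite (Basis :: quat set)"
    by (simp_all add: Basis_quat_def)
  show "inner u v = (if u = v then 1 else 0)" if "u \<in> Basis" "v \<in> Basis" for u v :: quat
    using that unfolding Basis_quat_def by (elim insertE emptyE; simp add: inner_quat_def)
  show "(\<forall>u\<in>Basis. inner p u = 0) \<longleftrightarrow> p = 0" for p :: quat
    by (simp add: Basis_quat_def inner_quat_def quat_eq_iff[of p])
qed

end


section \<open>Slices and slice regular functions\<close>

definition imag_sphere :: "quat set" where
  "imag_sphere = {i. qRe i = 0 \<and> norm i = 1}"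

definition slice_plane :: "quat \<Rightarrow> quat set" where
  "slice_plane i = {of_real x + of_real y * i | x y. True}"

definition slice :: "quat set \<Rightarrow> quat \<Rightarrow> quat set" where
  "slice \<Omega> i = \<Omega> \<inter> slice_plane i"

text \<open>Intended for open \<open>\<Omega>\<close>: then differentiability on \<open>\<Omega>\<close> makes the two partial derivatives
  below genuine, and the condition does not depend on the values outside \<open>\<Omega>\<close>.\<close>

definition slice_regular :: "quat set \<Rightarrow> (quat \<Rightarrow> quat) set" where
  "slice_regular \<Omega> = {f. (\<forall>q\<in>\<Omega>. f differentiable (at q)) \<and>
     (\<forall>i\<in>imag_sphere. \<forall>x y. of_real x + of_real y * i \<in> \<Omega> \<longrightarrow>
        vector_derivative (\<lambda>s. f (of_real s + of_real y * i)) (at x)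
        + i * vector_derivative (\<lambda>t. f (of_real x + of_real t * i)) (at y) = 0)}"


section \<open>The slice Bergman kernel of the second kind\<close>

text \<open>The area measure \<open>d\<sigma>(x + y j) = dx dy\<close> of the plane through \<open>1\<close> and \<open>j\<close>, as a measure
  on the quaternions.\<close>

definition slice_measure :: "quat \<Rightarrow> quat measure" where
  "slice_measure j = distr lborel borel (\<lambda>z::complex. of_real (Re z) + of_real (Im z) * j)"

definition bergman_space :: "quat set \<Rightarrow> quat \<Rightarrow> (quat \<Rightarrow> quat) set" where
  "bergman_space \<Omega> j =
     {f \<in> slice_regular \<Omega>. set_integrable (slice_measure j) (slice \<Omega> j) (\<lambda>p. (norm (f p))\<^sup>2)}"

definition bergman_inner :: "quat set \<Rightarrow> quat \<Rightarrow> (quat \<Rightarrow> quat) \<Rightarrow> (quat \<Rightarrow> quat) \<Rightarrow> quat" where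
  "bergman_inner \<Omega> j f g = (LINT p:slice \<Omega> j|slice_measure j. qcnj (f p) * g p)"

text \<open>\<open>extensional \<Omega>\<close> fixes the irrelevant values outside \<open>\<Omega>\<close>; without it the description would
  not be unique.\<close>

definition bergman_rep :: "quat set \<Rightarrow> quat \<Rightarrow> quat \<Rightarrow> quat \<Rightarrow> quat" where
  "bergman_rep \<Omega> j q = (THE K. K \<in> bergman_space \<Omega> j \<inter> extensional \<Omega> \<and>
     (\<forall>f\<in>bergman_space \<Omega> j. f q = bergman_inner \<Omega> j K f))"

definition slice_kernel :: "quat set \<Rightarrow> quat \<Rightarrow> quat \<Rightarrow> quat \<Rightarrow> quat" where
  "slice_kernel \<Omega> j q r = qcnj (bergman_rep \<Omega> j q r)"

text \<open>The value is described as the one obtained from every admissible choice of \<open>j\<close> for \<open>r\<close> and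
  of \<open>x, y, i\<close> for \<open>q\<close>.\<close>

definition bergman_kernel2 :: "quat set \<Rightarrow> quat \<Rightarrow> quat \<Rightarrow> quat" where
  "bergman_kernel2 \<Omega> q r = (THE k. \<forall>j\<in>imag_sphere. r \<in> slice \<Omega> j \<longrightarrow>
     (\<forall>i\<in>imag_sphere. \<forall>x y. q = of_real x + of_real y * i \<longrightarrow>
        k = (1/2) * (1 - i * j) * slice_kernel \<Omega> j (of_real x + of_real y * j) r
          + (1/2) * (1 + i * j) * slice_kernel \<Omega> j (of_real x - of_real y * j) r))"


section \<open>The Laplace operator\<close>

definition partial_deriv ::
  "'a::real_normed_vector \<Rightarrow> ('a \<Rightarrow> 'b::real_normed_vector) \<Rightarrow> 'a \<Rightarrow> 'b" where
  "partial_deriv b f q = vector_derivative (\<lambda>t::real. f (q + t *\<^sub>R b)) (at 0)"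

definition laplacian :: "('a::euclidean_space \<Rightarrow> 'b::real_normed_vector) \<Rightarrow> 'a \<Rightarrow> 'b" where
  "laplacian f q = (\<Sum>b\<in>Basis. partial_deriv b (partial_deriv b f) q)"

end

(* The kernel is made explicit. On the slice of j, the C(j)-linear coordinates of a slice regular
   function are holomorphic on the unit disc, so the function is reproduced by the classical kernel
   (1 - z cnj zeta)^-2 / pi. The disc formula itself comes from averaging over rotations, which
   preserve area: by Cauchy's formula the mean of F z / (1 - zeta cnj z)^2 over the circle through z
   is the derivative of u F(u zeta) at u = |z|^2, and the area of the disc is pi du in that variable.
   Slice extension then gives K(q, r) = P S^-2 / pi with w = cnj r,
   P = 1 - 2 cnj q w + (cnj q)^2 w^2 and S = 1 - 2 Re q w + |q|^2 w^2, where S commutes with w.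
   The Laplacian follows from Delta P = -4 w^2, Delta S = 8 w^2, grad P . grad S = 4 P w^2 and
   |grad S|^2 = 4 w^2 S. *)

theory Submission
  imports Defs "HOL-Complex_Analysis.Conformal_Mappings"
begin

section \<open>The Bergman kernel of the unit disc\<close>

text \<open>Both the representing function and the kernel are definite descriptions, so each
  explicit formula has to be shown to satisfy its description and to be its only solution. Integrals
  over one slice determine a representing function on that slice only; the real diameter, which lies
  in all slices, carries uniqueness to the rest of the ball, and \<open>extensional\<close> settles
  the values outside. The kernel's description ranges over every admissible pair of slices, and a
  real \<open>q\<close> or \<open>r\<close> lies in all of them, so the value must not depend on the
  choice; this is what the representation formula provides. Noncommutativity dictates the form of
  the calculus: \<open>qcnj q\<close> and \<open>qcnj r\<close> need not commute, so P is kept to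
  the left throughout, and only w, S and the derivatives of S are moved past each other.\<close>

lemma measurable_Complex[measurable]:
  "(\<lambda>(x, y). Complex x y) \<in> borel_measurable (lborel \<Otimes>\<^sub>M lborel)"
proof -
  have "(\<lambda>(x, y). Complex x y) = (\<lambda>p. complex_of_real (fst p) + \<i> * complex_of_real (snd p))"
    by (auto simp: complex_eq_iff)
  then show ?thesis
    by (simp add: borel_measurable_continuous_onI)
qed

text \<open>A box in the plane pulls back to a product of intervals, and Lebesgue measure is
  determined by its values on boxes. This makes Tonelli's theorem available in the coordinates
  \<open>Re\<close> and \<open>Im\<close>, in both orders.\<close>

lemma lborel_complex_eq_distr:
  "(lborel :: complex measure) = distr (lborel \<Otimes>\<^sub>M lborel) borel (\<lambda>(x, y). Complex x y)"
proof (rule lborel_eqI)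
  fix l u :: complex
  assume lu: "\<And>b. b \<in> Basis \<Longrightarrow> l \<bullet> b \<le> u \<bullet> b"
  then have le: "Re l \<le> Re u" "Im l \<le> Im u"
    using lu[of 1] lu[of \<i>] by (simp_all add: Basis_complex_def)
  have vim: "(\<lambda>(x, y). Complex x y) -` box l u = {Re l<..<Re u} \<times> {Im l<..<Im u}"
    by (auto simp: box_def Basis_complex_def)
  show "emeasure (distr (lborel \<Otimes>\<^sub>M lborel) borel (\<lambda>(x, y). Complex x y)) (box l u) =
      (\<Prod>b\<in>Basis. (u - l) \<bullet> b)"
    by (subst emeasure_distr)
      (use le in \<open>simp_all add: vim space_pair_measure lborel.emeasure_pair_measure_Times
        Basis_complex_def ennreal_mult\<close>)
qed simp

lemma nn_integral_lborel_complex: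
  assumes [measurable]: "f \<in> borel_measurable (borel :: complex measure)"
  shows "(\<integral>\<^sup>+z. f z \<partial>lborel) = (\<integral>\<^sup>+x. \<integral>\<^sup>+y. f (Complex x y) \<partial>lborel \<partial>lborel)"
    and "(\<integral>\<^sup>+z. f z \<partial>lborel) = (\<integral>\<^sup>+y. \<integral>\<^sup>+x. f (Complex x y) \<partial>lborel \<partial>lborel)"
proof -
  have *: "(\<integral>\<^sup>+z. f z \<partial>lborel) = (\<integral>\<^sup>+p. f (case p of (x, y) \<Rightarrow> Complex x y) \<partial>(lborel \<Otimes>\<^sub>M lborel))"
    by (subst lborel_complex_eq_distr, subst nn_integral_distr) simp_all
  have [measurable]: "(\<lambda>p. f (case p of (x, y) \<Rightarrow> Complex x y)) \<in> borel_measurable (lborel \<Otimes>\<^sub>M lborel)"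
    by measurable
  show "(\<integral>\<^sup>+z. f z \<partial>lborel) = (\<integral>\<^sup>+x. \<integral>\<^sup>+y. f (Complex x y) \<partial>lborel \<partial>lborel)"
    unfolding * by (subst lborel.nn_integral_fst[symmetric]) simp_all
  show "(\<integral>\<^sup>+z. f z \<partial>lborel) = (\<integral>\<^sup>+y. \<integral>\<^sup>+x. f (Complex x y) \<partial>lborel \<partial>lborel)"
    unfolding * by (subst lborel_pair.nn_integral_snd[symmetric]) simp_all
qed

text \<open>With the sheared coordinate integrated innermost, the shear becomes a translation of the
  line by an amount that is constant there.\<close>

lemma nn_integral_shear:
  assumes [measurable]: "f \<in> borel_measurable (borel :: complex measure)"
  shows "(\<integral>\<^sup>+z. f (z + of_real (a * Im z)) \<partial>lborel) = (\<integral>\<^sup>+z. f z \<partial>lborel)"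
    and "(\<integral>\<^sup>+z. f (z + \<i> * of_real (a * Re z)) \<partial>lborel) = (\<integral>\<^sup>+z. f z \<partial>lborel)"
proof -
  have [measurable]: "Re \<in> borel_measurable borel" "Im \<in> borel_measurable borel"
    by (auto intro!: borel_measurable_continuous_onI continuous_intros)
  have [measurable]: "(\<lambda>x. f (Complex x y)) \<in> borel_measurable borel"
    "(\<lambda>y. f (Complex x y)) \<in> borel_measurable borel" for x y
    using assms by (auto simp: Complex_eq)
  \<comment> \<open>The factor 1 gives the inner variable the affine form of
    \<open>nn_integral_real_affine\<close>, whose Jacobian is that factor.\<close>
  have "(\<integral>\<^sup>+z. f (z + of_real (a * Im z)) \<partial>lborel) =
      (\<integral>\<^sup>+y. \<integral>\<^sup>+x. f (Complex (a * y + 1 * x) y) \<partial>lborel \<partial>lborel)"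
    by (subst nn_integral_lborel_complex(2)) (simp_all add: Complex_eq algebra_simps)
  also have "\<dots> = (\<integral>\<^sup>+y. \<integral>\<^sup>+x. f (Complex x y) \<partial>lborel \<partial>lborel)"
  proof (rule nn_integral_cong)
    fix y
    show "(\<integral>\<^sup>+x. f (Complex (a * y + 1 * x) y) \<partial>lborel) = (\<integral>\<^sup>+x. f (Complex x y) \<partial>lborel)"
      using nn_integral_real_affine[of "\<lambda>x. f (Complex x y)" 1 "a * y"] by simp
  qed
  finally show "(\<integral>\<^sup>+z. f (z + of_real (a * Im z)) \<partial>lborel) = (\<integral>\<^sup>+z. f z \<partial>lborel)"
    by (simp add: nn_integral_lborel_complex(2)[of f])
  have "(\<integral>\<^sup>+z. f (z + \<i> * of_real (a * Re z)) \<partial>lborel) =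
      (\<integral>\<^sup>+x. \<integral>\<^sup>+y. f (Complex x (a * x + 1 * y)) \<partial>lborel \<partial>lborel)"
    by (subst nn_integral_lborel_complex(1)) (simp_all add: Complex_eq algebra_simps)
  also have "\<dots> = (\<integral>\<^sup>+x. \<integral>\<^sup>+y. f (Complex x y) \<partial>lborel \<partial>lborel)"
  proof (rule nn_integral_cong)
    fix x
    show "(\<integral>\<^sup>+y. f (Complex x (a * x + 1 * y)) \<partial>lborel) = (\<integral>\<^sup>+y. f (Complex x y) \<partial>lborel)"
      using nn_integral_real_affine[of "\<lambda>y. f (Complex x y)" 1 "a * x"] by simp
  qed
  finally show "(\<integral>\<^sup>+z. f (z + \<i> * of_real (a * Re z)) \<partial>lborel) = (\<integral>\<^sup>+z. f z \<partial>lborel)"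
    by (simp add: nn_integral_lborel_complex(1)[of f])
qed

text \<open>A rotation by less than a half turn is a product of three shears.\<close>

lemma nn_integral_rotate:
  assumes [measurable]: "f \<in> borel_measurable (borel :: complex measure)" and c: "norm c = 1"
  shows "(\<integral>\<^sup>+z. f (c * z) \<partial>lborel) = (\<integral>\<^sup>+z. f z \<partial>lborel)"
proof -
  have [measurable]: "Re \<in> borel_measurable borel" "Im \<in> borel_measurable borel"
    by (auto intro!: borel_measurable_continuous_onI continuous_intros)
  have *: "(\<integral>\<^sup>+z. g (c * z) \<partial>lborel) = (\<integral>\<^sup>+z. g z \<partial>lborel)"
    if c: "norm c = 1" "c \<noteq> -1" and [measurable]: "g \<in> borel_measurable (borel :: complex measure)" for g c
  proof -
    \<comment> \<open>For \<open>c = cis \<theta>\<close> these are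
      \<open>a = - tan (\<theta>/2)\<close> and \<open>b = sin \<theta>\<close>. The half-angle
      tangent is infinite exactly at \<open>c = -1\<close>, which is therefore excluded
      here.\<close>
    define a b where "a = - Im c / (1 + Re c)" and "b = Im c"
    have sq: "(Re c)\<^sup>2 + (Im c)\<^sup>2 = 1"
      using c(1) by (simp add: cmod_def)
    have ne: "1 + Re c \<noteq> 0"
    proof
      assume "1 + Re c = 0"
      then have "Re c = -1" by simp
      with sq have "Im c = 0" by simp
      with \<open>Re c = -1\<close> c(2) show False by (simp add: complex_eq_iff)
    qed
    have ab: "1 + a * b = Re c"
      using sq ne by (simp add: a_def b_def field_simps) (simp add: power2_eq_square algebra_simps)
    have "a + a * (1 + a * b) = a * (1 + Re c)"
      by (simp only: ab) (simp add: algebra_simps)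
    then have aab: "a + a * (1 + a * b) = - Im c"
      using ne by (simp add: a_def)
    let ?X = "\<lambda>z. z + complex_of_real (a * Im z)"
    let ?Y = "\<lambda>z. z + \<i> * complex_of_real (b * Re z)"
    have "c * z = ?X (?Y (?X z))" for z
    proof (rule complex_eqI)
      have "Re (?X (?Y (?X z))) = (1 + a * b) * Re z + (a + a * (1 + a * b)) * Im z"
        by (simp add: algebra_simps)
      also have "\<dots> = Re c * Re z + (- Im c) * Im z"
        by (simp only: aab) (simp only: ab)
      finally show "Re (c * z) = Re (?X (?Y (?X z)))" by simp
      have "Im (?X (?Y (?X z))) = (1 + a * b) * Im z + b * Re z"
        by (simp add: algebra_simps)
      also have "\<dots> = Re c * Im z + Im c * Re z"
        by (simp only: ab) (simp add: b_def)
      finally show "Im (c * z) = Im (?X (?Y (?X z)))" by simp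
    qed
    then have "(\<integral>\<^sup>+z. g (c * z) \<partial>lborel) = (\<integral>\<^sup>+z. g (?X (?Y (?X z))) \<partial>lborel)"
      by (simp only:)
    also have "\<dots> = (\<integral>\<^sup>+z. g (?X (?Y z)) \<partial>lborel)"
      by (rule nn_integral_shear(1)[where f="\<lambda>z. g (?X (?Y z))"]) measurable
    also have "\<dots> = (\<integral>\<^sup>+z. g (?X z) \<partial>lborel)"
      by (rule nn_integral_shear(2)[where f="\<lambda>z. g (?X z)"]) measurable
    also have "\<dots> = (\<integral>\<^sup>+z. g z \<partial>lborel)"
      by (rule nn_integral_shear(1)) measurable
    finally show ?thesis .
  qed
  \<comment> \<open>The excluded half turn is reached by rotating twice through half the angle: the
    principal square root is never -1.\<close>
  let ?d = "csqrt c"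
  have d: "norm ?d = 1" "?d \<noteq> -1"
  proof -
    show "norm ?d = 1"
      using c by simp
    show "?d \<noteq> -1"
    proof
      assume "?d = -1"
      then have "c = (-1)\<^sup>2"
        by (metis power2_csqrt)
      with \<open>?d = -1\<close> show False by simp
    qed
  qed
  have "(\<integral>\<^sup>+z. f (c * z) \<partial>lborel) = (\<integral>\<^sup>+z. f (?d * (?d * z)) \<partial>lborel)"
    by (simp add: mult.assoc[symmetric] power2_eq_square[symmetric])
  also have "\<dots> = (\<integral>\<^sup>+z. f (?d * z) \<partial>lborel)"
    by (rule *[OF d, of "\<lambda>z. f (?d * z)"]) measurable
  also have "\<dots> = (\<integral>\<^sup>+z. f z \<partial>lborel)"
    by (rule *[OF d]) measurable
  finally show ?thesis .
qed

lemma lborel_complex_rotate: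
  assumes "norm c = 1"
  shows "distr lborel borel ((*) c) = (lborel :: complex measure)"
proof (rule measure_eqI)
  fix A assume "A \<in> sets (distr lborel borel ((*) c))"
  then have [measurable]: "A \<in> sets borel" by simp
  have "emeasure (distr lborel borel ((*) c)) A = (\<integral>\<^sup>+z. indicator A z \<partial>distr lborel borel ((*) c))"
    by simp
  also have "\<dots> = (\<integral>\<^sup>+z. indicator A (c * z) \<partial>lborel)"
    by (rule nn_integral_distr) measurable
  also have "\<dots> = emeasure lborel A"
    by (subst nn_integral_rotate[OF _ assms]) simp_all
  finally show "emeasure (distr lborel borel ((*) c)) A = emeasure lborel A" .
qed simp

section \<open>Circle means and radial integration on the disc\<close>

text \<open>The disc of radius \<open>sqrt x\<close> has area \<open>pi * x\<close>, linear in
  \<open>x\<close>; hence \<open>(norm z)\<^sup>2\<close> has constant density. The two measures are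
  compared on the half-lines \<open>{x<..}\<close>.\<close>

lemma radial_distr:
  "distr (restrict_space lborel (ball (0::complex) 1)) borel (\<lambda>z. (norm z)\<^sup>2) =
    density lborel (\<lambda>u. ennreal pi * indicator {0..1} u)" (is "?M = ?N")
proof (rule measure_eqI_lessThan)
  have M: "emeasure ?M {x<..} = emeasure lborel {z::complex. norm z < 1 \<and> x < (norm z)\<^sup>2}" for x
    by (subst emeasure_distr)
      (auto simp: emeasure_restrict_space space_restrict_space vimage_def
        intro!: arg_cong[where f="emeasure lborel"] measurable_restrict_space1)
  have N: "emeasure ?N {x<..} = ennreal pi * emeasure lborel ({0..1} \<inter> {x<..})" for x
    by (subst emeasure_density) (auto simp: mult.assoc nn_integral_cmult indicator_inter_arith[symmetric])
  have ball: "emeasure lborel (ball (0::complex) r) = ennreal (pi * r\<^sup>2)" if "r \<ge> 0" for r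
    using emeasure_ball[of r "0::complex"] that by (simp add: unit_ball_vol_2 ennreal_mult)
  have cball: "emeasure lborel (cball (0::complex) r) = ennreal (pi * r\<^sup>2)" if "r \<ge> 0" for r
    using emeasure_cball[of r "0::complex"] that by (simp add: unit_ball_vol_2 ennreal_mult)
  have iff: "sqrt x < norm z \<longleftrightarrow> x < (norm z)\<^sup>2" for x and z :: complex
    by (metis real_sqrt_less_iff real_sqrt_abs abs_norm_cancel)
  show "emeasure ?M {x<..} = emeasure ?N {x<..}" for x
  proof -
    consider "x < 0" | "0 \<le> x" "x < 1" | "x \<ge> 1" by linarith
    then show ?thesis
    proof cases
      case 1
      then have "{z::complex. norm z < 1 \<and> x < (norm z)\<^sup>2} = ball 0 1" "{0..1} \<inter> {x<..} = {0..1}"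
        by (auto intro: less_le_trans)
      then show ?thesis by (simp only: M N ball) (simp add: ball)
    next
      case 2
      have "{z::complex. norm z < 1 \<and> x < (norm z)\<^sup>2} = ball 0 1 - cball 0 (sqrt x)"
        by (simp add: set_eq_iff not_le iff)
      then have "emeasure ?M {x<..} = emeasure lborel (ball (0::complex) 1 - cball 0 (sqrt x))"
        by (simp only: M)
      also have "\<dots> = emeasure lborel (ball (0::complex) 1) - emeasure lborel (cball (0::complex) (sqrt x))"
      proof (rule emeasure_Diff)
        have "sqrt x < 1" using 2 by simp
        then show "cball 0 (sqrt x) \<subseteq> ball (0::complex) 1"
          using le_less_trans[of _ "sqrt x" 1] by (simp only: subset_iff mem_cball mem_ball) blast
      qed (use 2 in \<open>auto simp: cball\<close>)
      also have "\<dots> = ennreal (pi - pi * x)"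
        using 2 by (simp add: ball cball ennreal_minus)
      finally have "emeasure ?M {x<..} = ennreal (pi - pi * x)" .
      moreover have "{0..1} \<inter> {x<..} = {x<..1}" using 2 by auto
      moreover have "pi * (1 - x) = pi - pi * x"
        by (simp add: algebra_simps)
      ultimately show ?thesis
        using 2 by (simp add: N ennreal_mult[symmetric])
    next
      case 3
      have "\<not> x < (norm z)\<^sup>2" if "norm z < 1" for z :: complex
        using power_le_one[of "norm z" 2] that 3 by simp
      then have e: "{z::complex. norm z < 1 \<and> x < (norm z)\<^sup>2} = {}"
        by blast
      have "{0..1} \<inter> {x<..} = {}" using 3 by auto
      then show ?thesis by (simp add: M N e)
    qed
  qed
  note * = this
  show "emeasure ?M {x<..} < \<infinity>" for x
  proof -
    have "emeasure lborel ({0..1} \<inter> {x<..}) \<le> emeasure lborel {0..1::real}"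
      by (rule emeasure_mono) auto
    then have "emeasure lborel ({0..1} \<inter> {x<..}) < \<infinity>"
      by (simp add: le_less_trans)
    with * show ?thesis
      by (simp add: N ennreal_mult_less_top)
  qed
qed simp_all

text \<open>On the circle of radius s about 0 one has \<open>cnj x = s\<^sup>2 / x\<close>, so the
  antiholomorphic factor becomes rational: \<open>1 - \<zeta> * cnj (u * x) = (x - v) / x\<close>.
  Since \<open>dt = dx / (\<i> * x)\<close>, the integral is Cauchy's formula for the derivative of
  \<open>x * F (u * x)\<close> at \<open>v\<close>, and \<open>u * v = w\<close>.\<close>

lemma circle_mean_bergman:
  assumes F: "F holomorphic_on ball 0 1" and \<zeta>: "norm \<zeta> < 1" and z: "norm z < 1"
  defines "w \<equiv> of_real ((norm z)\<^sup>2) * \<zeta>"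
  shows "((\<lambda>t. F (cis t * z) / (1 - \<zeta> * cnj (cis t * z))\<^sup>2) has_integral
    2 * of_real pi * (F w + w * deriv F w)) {0..2 * pi}"
proof (cases "z = 0")
  case True
  then show ?thesis
    using has_integral_const_real[of "F 0" 0 "2 * pi"] by (simp add: w_def scaleR_conv_of_real)
next
  case False
  \<comment> \<open>\<open>u\<close> is the direction of \<open>z\<close>; factoring it out lets the
    standard path \<open>circlepath 0 s\<close> be used. The pole \<open>v\<close> has modulus
    \<open>s\<^sup>2 * norm \<zeta> < s\<close>, so it lies inside.\<close>
  define s u v where "s = norm z" and "u = z / of_real s" and "v = of_real (s\<^sup>2) * (\<zeta> * cnj u)"
  have s: "0 < s" "s < 1" and u: "norm u = 1" and zu: "z = of_real s * u"
    using False z by (auto simp: s_def u_def norm_divide)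
  have uu: "u * cnj u = 1"
    using complex_norm_square[of u] u by simp
  have uv: "u * v = w"
    using uu by (simp add: v_def w_def s_def)
  have v: "norm v < s"
  proof -
    have "norm v = s * (s * norm \<zeta>)"
      by (simp add: v_def norm_mult u power2_eq_square norm_power s_def)
    also have "\<dots> < s * 1"
      using s \<zeta> mult_strict_mono'[of s 1 "norm \<zeta>" 1] by (intro mult_strict_left_mono) auto
    finally show ?thesis by simp
  qed
  have w: "norm w < 1"
    using v s uv u by (metis norm_mult mult_1 less_trans)
  define f where "f = (\<lambda>x. x * F (u * x))"
  have hol: "f holomorphic_on ball 0 1"
    unfolding f_def
    by (intro holomorphic_intros holomorphic_on_compose_gen[OF _ F, unfolded o_def])
      (auto simp: norm_mult u)
  have cont: "continuous_on (cball 0 s) f"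
    using hol s by (intro holomorphic_on_imp_continuous_on holomorphic_on_subset[OF hol]) auto
  have hols: "f holomorphic_on ball 0 s"
    using s by (intro holomorphic_on_subset[OF hol]) auto
  define I where "I = contour_integral (circlepath 0 s) (\<lambda>x. f x / (x - v)\<^sup>2)"
  have int: "(\<lambda>x. f x / (x - v)\<^sup>2) contour_integrable_on circlepath 0 s"
    and der: "(f has_field_derivative (1 / (2 * of_real pi * \<i>) * I)) (at v)"
    unfolding I_def using Cauchy_derivative_integral_circlepath[OF cont hols] v by auto
  have dF: "(F has_field_derivative deriv F w) (at (u * v))"
    using F w holomorphic_derivI[OF F, of w] by (simp add: uv)
  have dF2: "((\<lambda>x. F (u * x)) has_field_derivative deriv F w * u) (at v)"
    by (rule DERIV_chain2[of F "deriv F w" "\<lambda>x. u * x" v, OF dF]) (auto intro!: derivative_eq_intros)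
  have "(f has_field_derivative (F w + w * deriv F w)) (at v)"
    unfolding f_def
    by (rule DERIV_cong[OF DERIV_mult[OF DERIV_ident dF2]]) (simp add: uv[symmetric] algebra_simps)
  with der have "1 / (2 * of_real pi * \<i>) * I = F w + w * deriv F w"
    by (rule DERIV_unique)
  then have I: "I = 2 * of_real pi * \<i> * (F w + w * deriv F w)"
    by (simp add: field_simps)
  have "((\<lambda>x. f x / (x - v)\<^sup>2) has_contour_integral I) (circlepath 0 s)"
    unfolding I_def using int by (rule has_contour_integral_integral)
  then have "((\<lambda>t. f (0 + of_real s * cis t) / (0 + of_real s * cis t - v)\<^sup>2 * of_real s * \<i> * cis t) has_integral I) {0..2*pi}"
    unfolding circlepath_def by (subst (asm) has_contour_integral_part_circlepath_iff) simp_all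
  then have "((\<lambda>t. (f (0 + of_real s * cis t) / (0 + of_real s * cis t - v)\<^sup>2 * of_real s * \<i> * cis t) / \<i>) has_integral I / \<i>) {0..2*pi}"
    by (rule has_integral_divide)
  also have "(\<lambda>t. (f (0 + of_real s * cis t) / (0 + of_real s * cis t - v)\<^sup>2 * of_real s * \<i> * cis t) / \<i>) =
     (\<lambda>t. F (cis t * z) / (1 - \<zeta> * cnj (cis t * z))\<^sup>2)"
  proof
    fix t
    define X where "X = of_real s * cis t"
    have X: "X \<noteq> 0" using s by (simp add: X_def)
    have "norm X = s"
      using s by (simp add: X_def norm_mult)
    then have XX: "X * cnj X = of_real (s\<^sup>2)"
      using complex_norm_square[of X] by simp
    have uX: "cis t * z = u * X"
      by (simp add: X_def zu)
    have Xv: "X - v = X * (1 - \<zeta> * cnj (u * X))"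
      unfolding v_def XX[symmetric] by (simp add: algebra_simps)
    have *: "X * F (u * X) / (X - v)\<^sup>2 * X = F (u * X) / (1 - \<zeta> * cnj (u * X))\<^sup>2"
      using X unfolding Xv by (simp add: power_mult_distrib power2_eq_square)
    then show "(f (0 + of_real s * cis t) / (0 + of_real s * cis t - v)\<^sup>2 * of_real s * \<i> * cis t) / \<i> =
       F (cis t * z) / (1 - \<zeta> * cnj (cis t * z))\<^sup>2"
    proof -
      have "Y * of_real s * \<i> * cis t / \<i> = Y * X" for Y
        by (simp only: X_def nonzero_divide_eq_eq[OF complex_i_not_zero] mult_ac)
      then have "(f X / (X - v)\<^sup>2 * of_real s * \<i> * cis t) / \<i> = X * F (u * X) / (X - v)\<^sup>2 * X"
        by (simp only: f_def)
      with * show ?thesis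
        by (simp only: X_def[symmetric] uX add_0_left)
    qed
  qed
  also have "I / \<i> = 2 * of_real pi * (F w + w * deriv F w)"
    by (simp only: I nonzero_divide_eq_eq[OF complex_i_not_zero] mult_ac)
  finally show ?thesis .
qed

lemma integral_radial_disc:
  assumes G: "continuous_on {0..1} (G :: real \<Rightarrow> complex)"
  shows "(LINT z:ball (0::complex) 1|lborel. G ((norm z)\<^sup>2)) = of_real pi * (LINT u:{0..1}|lborel. G u)"
proof -
  \<comment> \<open>\<open>G\<close> is controlled on \<open>{0..1}\<close> only; cutting it off
    there gives a Borel function on the whole line, as the change of measure requires.\<close>
  define g where "g = (\<lambda>u. indicator {0..1} u *\<^sub>R G u)"
  have [measurable]: "g \<in> borel_measurable borel"
    unfolding g_def using G by (intro borel_measurable_continuous_on_indicator) auto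
  have "(LINT z:ball (0::complex) 1|lborel. G ((norm z)\<^sup>2)) = (LINT z:ball (0::complex) 1|lborel. g ((norm z)\<^sup>2))"
    by (intro set_lebesgue_integral_cong) (auto simp: g_def power_le_one)
  also have "\<dots> = (LINT z|restrict_space lborel (ball (0::complex) 1). g ((norm z)\<^sup>2))"
    by (simp add: integral_restrict_space set_lebesgue_integral_def)
  also have "\<dots> = (LINT u|distr (restrict_space lborel (ball (0::complex) 1)) borel (\<lambda>z. (norm z)\<^sup>2). g u)"
    by (subst integral_distr) (auto intro!: measurable_restrict_space1)
  also have "\<dots> = (LINT u|lborel. (pi * indicator {0..1} u) *\<^sub>R g u)"
    unfolding radial_distr
    by (subst integral_density[symmetric]) (auto simp: ennreal_mult' ennreal_indicator)
  also have "\<dots> = (LINT u|lborel. of_real pi * g u)"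
    by (intro Bochner_Integration.integral_cong) (auto simp: g_def scaleR_conv_of_real indicator_def)
  also have "\<dots> = of_real pi * (LINT u:{0..1}|lborel. G u)"
    unfolding set_lebesgue_integral_def g_def by (rule integral_mult_right_zero)
  finally show ?thesis .
qed

lemma norm_one_minus_mult_cnj:
  assumes "norm \<zeta> < 1" "norm z < 1"
  shows "1 - norm \<zeta> \<le> norm (1 - \<zeta> * cnj z)"
proof -
  have "1 - norm \<zeta> \<le> 1 - norm (\<zeta> * cnj z)"
    using assms by (simp add: norm_mult mult_left_le)
  also have "\<dots> \<le> norm (1 - \<zeta> * cnj z)"
    using norm_triangle_ineq2[of 1 "\<zeta> * cnj z"] by simp
  finally show ?thesis .
qed

text \<open>For fixed \<open>\<zeta>\<close> the kernel is bounded on the disc by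
  \<open>1 / (1 - norm \<zeta>)\<^sup>2\<close>.\<close>

lemma set_integrable_bergman:
  fixes F :: "complex \<Rightarrow> complex"
  assumes F: "set_integrable lborel (ball 0 1) F" and \<zeta>: "norm \<zeta> < 1"
  shows "set_integrable lborel (ball 0 1) (\<lambda>z. F z / (1 - \<zeta> * cnj z)\<^sup>2)"
proof -
  have [measurable]: "(\<lambda>z. indicator (ball 0 1) z *\<^sub>R F z) \<in> borel_measurable borel"
    using F by (simp add: set_integrable_def)
  have [measurable]: "cnj \<in> borel_measurable borel"
    by (intro borel_measurable_continuous_onI continuous_intros)
  have eq: "indicator (ball 0 1) z *\<^sub>R (F z / (1 - \<zeta> * cnj z)\<^sup>2) =
      (indicator (ball 0 1) z *\<^sub>R F z) / (1 - \<zeta> * cnj z)\<^sup>2" for z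
    by (simp add: indicator_def)
  show ?thesis
    unfolding set_integrable_def
  proof (rule Bochner_Integration.integrable_bound)
    show "integrable lborel (\<lambda>z. (1 / (1 - norm \<zeta>)\<^sup>2) *\<^sub>R (indicator (ball 0 1) z *\<^sub>R F z))"
      using F unfolding set_integrable_def by (rule integrable_scaleR_right)
    show "(\<lambda>z. indicator (ball 0 1) z *\<^sub>R (F z / (1 - \<zeta> * cnj z)\<^sup>2)) \<in> borel_measurable lborel"
      unfolding eq by measurable
    show "AE z in lborel. norm (indicator (ball 0 1) z *\<^sub>R (F z / (1 - \<zeta> * cnj z)\<^sup>2)) \<le>
        norm ((1 / (1 - norm \<zeta>)\<^sup>2) *\<^sub>R (indicator (ball 0 1) z *\<^sub>R F z))"
    proof (rule AE_I2)
      fix z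
      show "norm (indicator (ball 0 1) z *\<^sub>R (F z / (1 - \<zeta> * cnj z)\<^sup>2)) \<le>
        norm ((1 / (1 - norm \<zeta>)\<^sup>2) *\<^sub>R (indicator (ball 0 1) z *\<^sub>R F z))"
      proof (cases "z \<in> ball 0 1")
        case True
        then have "norm (F z) / (norm (1 - \<zeta> * cnj z))\<^sup>2 \<le> norm (F z) / (1 - norm \<zeta>)\<^sup>2"
          using \<zeta> norm_one_minus_mult_cnj[OF \<zeta>, of z]
          by (intro divide_left_mono power_mono mult_pos_pos zero_less_power) auto
        then show ?thesis
          using True by (simp add: norm_divide norm_power)
      qed simp
    qed
  qed
qed

text \<open>Every rotation leaves the integral unchanged, so it may be averaged over the angle.
  Fubini moves the average inside, where it depends on \<open>(norm z)\<^sup>2\<close> alone;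
  rotation invariance and the law of \<open>(norm z)\<^sup>2\<close> thus replace a change to polar
  coordinates.\<close>

theorem bergman_reproducing_disc:
  assumes F: "F holomorphic_on ball 0 1" and int: "set_integrable lborel (ball 0 1) F"
    and \<zeta>: "norm \<zeta> < 1"
  shows "(LINT z:ball 0 1|lborel. F z / (1 - \<zeta> * cnj z)\<^sup>2) = of_real pi * F \<zeta>"
proof -
  define h where "h = (\<lambda>z. indicator (ball 0 1) z *\<^sub>R (F z / (1 - \<zeta> * cnj z)\<^sup>2))"
  define g where "g = (\<lambda>(t, z). indicator {0..2 * pi} t *\<^sub>R h (cis t * z))"
  \<comment> \<open>This is the derivative of \<open>u * F (u * \<zeta>)\<close>; at
    \<open>u = (norm z)\<^sup>2\<close> it is the circle mean through \<open>z\<close>.\<close>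
  define G where "G = (\<lambda>u. F (of_real u * \<zeta>) + of_real u * \<zeta> * deriv F (of_real u * \<zeta>))"
  have h: "integrable lborel h"
    using set_integrable_bergman[OF int \<zeta>] by (simp add: set_integrable_def h_def)
  then have [measurable]: "h \<in> borel_measurable borel"
    by simp
  have rot: "integrable lborel (\<lambda>z. k (cis t * z))"
      "(LINT z|lborel. k (cis t * z)) = integral\<^sup>L lborel k"
    if k: "integrable lborel k" for k :: "complex \<Rightarrow> 'b::{banach, second_countable_topology}" and t
  proof -
    have d: "distr lborel borel ((*) (cis t)) = lborel"
      by (rule lborel_complex_rotate) simp
    have [measurable]: "k \<in> borel_measurable borel" using k by simp
    show "integrable lborel (\<lambda>z. k (cis t * z))"
      using k by (subst (asm) d[of, symmetric], subst (asm) integrable_distr_eq) auto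
    show "(LINT z|lborel. k (cis t * z)) = integral\<^sup>L lborel k"
      by (subst (2) d[symmetric], subst integral_distr) auto
  qed
  have line: "of_real u * \<zeta> \<in> ball 0 1" if "u \<in> {0..1}" for u
    using that \<zeta> by (auto simp: norm_mult intro: le_less_trans[OF mult_left_le_one_le])
  have contG: "continuous_on {0..1} G"
    unfolding G_def
    by (intro continuous_intros
        continuous_on_compose2[OF holomorphic_on_imp_continuous_on[OF F]]
        continuous_on_compose2[OF holomorphic_on_imp_continuous_on[OF holomorphic_deriv[OF F open_ball]]])
      (auto dest: line)
  have [measurable]: "(\<lambda>p. cis (fst p) * snd p) \<in> borel_measurable (lborel \<Otimes>\<^sub>M lborel)"
    by (simp add: lborel_prod) (intro borel_measurable_continuous_onI continuous_intros)
  have gm[measurable]: "g \<in> borel_measurable (lborel \<Otimes>\<^sub>M lborel)"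
    unfolding g_def split_beta by measurable
  \<comment> \<open>The inner integral of the norm does not depend on \<open>t\<close>, by rotation
    invariance, and \<open>t\<close> runs over a bounded interval.\<close>
  have g: "integrable (lborel \<Otimes>\<^sub>M lborel) g"
  proof (rule lborel_pair.Fubini_integrable[OF gm])
    have "(LINT z|lborel. norm (g (t, z))) = indicator {0..2*pi} t * (LINT z|lborel. norm (h z))" for t
      using rot(2)[OF integrable_norm[OF h], of t] by (simp add: g_def)
    then show "integrable lborel (\<lambda>t. LINT z|lborel. norm (g (t, z)))"
      by simp
    show "AE t in lborel. integrable lborel (\<lambda>z. g (t, z))"
      using rot(1)[OF h] by (simp add: g_def)
  qed
  have "(LINT t|lborel. LINT z|lborel. g (t, z)) = (LINT t|lborel. indicator {0..2*pi} t *\<^sub>R integral\<^sup>L lborel h)"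
    using rot(2)[OF h] by (simp add: g_def)
  also have "\<dots> = 2 * of_real pi * integral\<^sup>L lborel h"
    by (simp add: scaleR_conv_of_real)
  finally have 1: "(LINT t|lborel. LINT z|lborel. g (t, z)) = 2 * of_real pi * integral\<^sup>L lborel h" .
  \<comment> \<open>The circle mean is known as a gauge integral; integrability in \<open>t\<close>,
    which Fubini gives for almost every \<open>z\<close>, identifies it with the Lebesgue
    integral.\<close>
  have inner: "(LINT t|lborel. g (t, z)) = indicator (ball 0 1) z *\<^sub>R (2 * of_real pi * G ((norm z)\<^sup>2))"
    if "integrable lborel (\<lambda>t. g (t, z))" for z
  proof (cases "norm z < 1")
    case True
    have "((\<lambda>t. g (t, z)) has_integral (LINT t|lborel. g (t, z))) UNIV"
      using has_integral_integral_lborel[OF that] .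
    moreover have "((\<lambda>t. g (t, z)) has_integral 2 * of_real pi * G ((norm z)\<^sup>2)) UNIV"
    proof -
      have "(\<lambda>t. g (t, z)) = (\<lambda>t. if t \<in> {0..2*pi} then F (cis t * z) / (1 - \<zeta> * cnj (cis t * z))\<^sup>2 else 0)"
        using True by (auto simp: g_def h_def norm_mult)
      then show ?thesis
        using circle_mean_bergman[OF F \<zeta> True] by (simp only: has_integral_restrict_UNIV) (simp add: G_def)
    qed
    ultimately show ?thesis
      using True has_integral_unique by auto
  next
    case False
    then have "g (t, z) = 0" for t
      by (simp add: g_def h_def norm_mult)
    with False show ?thesis by simp
  qed
  have "(LINT t|lborel. LINT z|lborel. g (t, z)) = (LINT z|lborel. LINT t|lborel. g (t, z))"
    using lborel_pair.Fubini_integral[of "curry g"] g by (simp add: curry_def)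
  also have "\<dots> = (LINT z|lborel. 2 * of_real pi * (indicator (ball 0 1) (z :: complex) *\<^sub>R G ((norm z)\<^sup>2)))"
  proof (rule Bochner_Integration.integral_cong_AE)
    show "(\<lambda>z. LINT t|lborel. g (t, z)) \<in> borel_measurable lborel"
      using lborel_pair.integrable_snd[of "curry g"] g by (simp add: curry_def)
    have "AE z in lborel. integrable lborel (\<lambda>t. g (t, z))"
      using lborel_pair.AE_integrable_snd[of "curry g"] g by (simp add: curry_def)
    then show *: "AE z in lborel. (LINT t|lborel. g (t, z)) = 2 * of_real pi * (indicator (ball 0 1) z *\<^sub>R G ((norm z)\<^sup>2))"
      by eventually_elim (simp add: inner)
    have "continuous_on (ball 0 1) (\<lambda>z::complex. G ((norm z)\<^sup>2))"
      by (intro continuous_on_compose2[OF contG] continuous_intros) (auto simp: power_le_one)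
    then have "(\<lambda>z::complex. indicator (ball 0 1) z *\<^sub>R G ((norm z)\<^sup>2)) \<in> borel_measurable borel"
      by (intro borel_measurable_continuous_on_indicator) auto
    then show "(\<lambda>z::complex. 2 * of_real pi * (indicator (ball 0 1) z *\<^sub>R G ((norm z)\<^sup>2))) \<in> borel_measurable lborel"
      by (intro borel_measurable_times) simp_all
  qed
  also have "\<dots> = 2 * of_real pi * (LINT z:ball (0::complex) 1|lborel. G ((norm z)\<^sup>2))"
    unfolding set_lebesgue_integral_def by (rule integral_mult_right_zero)
  also have "(LINT z:ball (0::complex) 1|lborel. G ((norm z)\<^sup>2)) = of_real pi * (LINT u:{0..1}|lborel. G u)"
    using contG by (rule integral_radial_disc)
  also have "(LINT u:{0..1}|lborel. G u) = F \<zeta>"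
  proof -
    \<comment> \<open>The antiderivative vanishes at 0 because of the factor \<open>u\<close>, so
      only its value \<open>F \<zeta>\<close> at 1 survives.\<close>
    have "((\<lambda>u. of_real u * F (of_real u * \<zeta>)) has_vector_derivative G u) (at u within {0..1})"
      if u: "0 \<le> u" "u \<le> 1" for u
    proof -
      have d: "(F has_field_derivative deriv F (of_real u * \<zeta>)) (at (of_real u * \<zeta>))"
        using u line[of u] by (intro holomorphic_derivI[OF F]) auto
      have "((\<lambda>x. x * F (x * \<zeta>)) has_field_derivative G u) (at (of_real u))"
        unfolding G_def by (auto intro!: derivative_eq_intros DERIV_chain2[of F "deriv F (of_real u * \<zeta>)" "\<lambda>x. x * \<zeta>" "of_real u", OF d] simp: algebra_simps)
      then have "((\<lambda>x. x * F (x * \<zeta>)) has_field_derivative G u) (at (of_real u) within of_real ` {0..1})"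
        by (rule has_field_derivative_at_within)
      moreover have "(complex_of_real has_vector_derivative 1) (at u within {0..1})"
        by (auto intro!: derivative_eq_intros)
      ultimately show ?thesis
        using field_vector_diff_chain_within[of complex_of_real 1 u "{0..1}" "\<lambda>x. x * F (x * \<zeta>)" "G u"]
        by (simp add: o_def)
    qed
    then have "(LINT u|lborel. indicator {0..1} u *\<^sub>R G u) =
        of_real 1 * F (of_real 1 * \<zeta>) - of_real 0 * F (of_real 0 * \<zeta>)"
      by (intro integral_FTC_atLeastAtMost contG) simp_all
    then show ?thesis
      by (simp only: set_lebesgue_integral_def) simp
  qed
  finally have "integral\<^sup>L lborel h = of_real pi * F \<zeta>"
    unfolding 1 by simp
  then show ?thesis
    by (simp only: h_def set_lebesgue_integral_def)
qed

section \<open>Slices of the quaternions\<close>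

lemma quat_of_real_sel [simp]:
  "qRe (of_real x) = x" "qIm1 (of_real x) = 0" "qIm2 (of_real x) = 0" "qIm3 (of_real x) = 0"
  by (simp_all add: of_real_def)

lemma quat_numeral_sel [simp]:
  "qRe (numeral n) = numeral n" "qIm1 (numeral n) = 0" "qIm2 (numeral n) = 0" "qIm3 (numeral n) = 0"
  using quat_of_real_sel[of "numeral n"] by (simp_all del: quat_of_real_sel)

lemma quat_two: "2 * v = 2 *\<^sub>R v" for v :: quat
  by (simp add: scaleR_conv_of_real)

lemma qcnj_add: "qcnj (p + q) = qcnj p + qcnj q"
  and qcnj_mult: "qcnj (p * q) = qcnj q * qcnj p"
  and qcnj_qcnj [simp]: "qcnj (qcnj p) = p"
  by (simp_all add: quat_eq_iff)

lemma norm_qcnj [simp]: "norm (qcnj p) = norm p"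
  by (simp add: norm_quat_def inner_quat_def)

lemma norm_quat_sq: "(norm p)\<^sup>2 = (qRe p)\<^sup>2 + (qIm1 p)\<^sup>2 + (qIm2 p)\<^sup>2 + (qIm3 p)\<^sup>2"
  unfolding power2_norm_eq_inner inner_quat_def by (simp add: power2_eq_square)

lemma bounded_linear_qcnj: "bounded_linear qcnj"
  unfolding linear_conv_bounded_linear[symmetric]
  by (rule linearI) (simp_all add: quat_eq_iff)

lemma imag_sphere_sq: "j \<in> imag_sphere \<Longrightarrow> j * j = -1"
  using norm_quat_sq[of j] by (simp add: imag_sphere_def quat_eq_iff power2_eq_square)

section \<open>The complex plane embedded as a slice\<close>

text \<open>Real linear for every \<open>j\<close>; for \<open>j\<close> in
  \<open>imag_sphere\<close> it is moreover an isometric embedding of algebras with image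
  \<open>slice_plane j\<close>, so computations within one slice can be carried out in the
  commutative field of complex numbers.\<close>

definition cslice :: "quat \<Rightarrow> complex \<Rightarrow> quat" where
  "cslice j z = of_real (Re z) + of_real (Im z) * j"

lemma bounded_linear_cslice: "bounded_linear (cslice j)"
  unfolding linear_conv_bounded_linear[symmetric]
  by (rule linearI) (simp_all add: cslice_def scaleR_conv_of_real algebra_simps)

lemmas cslice_add = linear_add[OF bounded_linear.linear[OF bounded_linear_cslice]]
lemmas cslice_diff = linear_diff[OF bounded_linear.linear[OF bounded_linear_cslice]]
lemmas cslice_scaleR = linear_scale[OF bounded_linear.linear[OF bounded_linear_cslice]]

lemma cslice_of_real [simp]: "cslice j (of_real x) = of_real x"
  and cslice_1 [simp]: "cslice j 1 = 1"
  and cslice_0 [simp]: "cslice j 0 = 0"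
  and cslice_ii [simp]: "cslice j \<i> = j"
  by (simp_all add: cslice_def)

lemma cslice_numeral [simp]: "cslice j (numeral n) = numeral n"
  using cslice_of_real[of j "numeral n"] by (simp del: cslice_of_real)

lemma cslice_mult:
  assumes "j \<in> imag_sphere"
  shows "cslice j (z * w) = cslice j z * cslice j w"
  by (simp add: cslice_def of_real_def algebra_simps imag_sphere_sq[OF assms])

lemma cslice_power: "j \<in> imag_sphere \<Longrightarrow> cslice j (z ^ n) = cslice j z ^ n"
  by (induction n) (simp_all add: cslice_mult)

lemma cslice_cnj: "j \<in> imag_sphere \<Longrightarrow> cslice j (cnj z) = qcnj (cslice j z)"
  by (simp add: cslice_def imag_sphere_def quat_eq_iff)

lemma qRe_cslice: "j \<in> imag_sphere \<Longrightarrow> qRe (cslice j z) = Re z"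
  by (simp add: cslice_def imag_sphere_def)

lemma norm_cslice:
  assumes "j \<in> imag_sphere"
  shows "norm (cslice j z) = norm z"
proof -
  have "inner (cslice j z) (cslice j z) = (Re z)\<^sup>2 + (Im z)\<^sup>2 * (norm j)\<^sup>2"
    unfolding norm_quat_sq using assms
    by (simp add: cslice_def imag_sphere_def inner_quat_def power2_eq_square algebra_simps)
  with assms show ?thesis
    by (simp add: norm_eq_sqrt_inner[of "cslice j z"] cmod_def imag_sphere_def)
qed

lemma cslice_eq_0_iff: "j \<in> imag_sphere \<Longrightarrow> cslice j z = 0 \<longleftrightarrow> z = 0"
  using norm_cslice[of j z] by (metis norm_eq_zero)

lemma cslice_inverse:
  assumes "j \<in> imag_sphere"
  shows "cslice j (inverse z) = inverse (cslice j z)"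
proof (cases "z = 0")
  case False
  then have "cslice j z * cslice j (inverse z) = 1"
    using assms by (simp add: cslice_mult[symmetric])
  then show ?thesis by (metis inverse_unique)
qed simp

lemma slice_plane_eq: "slice_plane j = range (cslice j)"
proof -
  have "of_real x + of_real y * j = cslice j (Complex x y)" for x y
    by (simp add: cslice_def)
  then show ?thesis
    by (auto simp: slice_plane_def) (auto simp: cslice_def)
qed

lemma imag_sphere_nonempty: "Quat 0 1 0 0 \<in> imag_sphere"
  by (simp add: imag_sphere_def norm_quat_def inner_quat_def)

lemma quat_in_some_slice: obtains j z where "j \<in> imag_sphere" "p = cslice j z"
proof (cases "qIm1 p = 0 \<and> qIm2 p = 0 \<and> qIm3 p = 0")
  case True
  then have "p = cslice (Quat 0 1 0 0) (of_real (qRe p))"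
    by (simp add: quat_eq_iff cslice_def)
  then show ?thesis using that imag_sphere_nonempty by blast
next
  case False
  define v where "v = Quat 0 (qIm1 p) (qIm2 p) (qIm3 p)"
  have "v \<noteq> 0" using False by (auto simp: v_def quat_eq_iff)
  then have "v /\<^sub>R norm v \<in> imag_sphere"
    by (simp add: imag_sphere_def v_def)
  moreover have "p = cslice (v /\<^sub>R norm v) (Complex (qRe p) (norm v))"
    using \<open>v \<noteq> 0\<close> by (simp add: cslice_def of_real_def) (simp add: v_def quat_eq_iff)
  ultimately show ?thesis using that by blast
qed

text \<open>The \<open>\<complex>(j)\<close>-linear coordinates of a quaternion for left multiplication: together, over all
  \<open>u\<close>, they detect a quaternion, so that vector-valued identities reduce to scalar holomorphic
  ones without splitting the quaternions as \<open>\<complex>(j) \<oplus> \<complex>(j) k\<close>.\<close>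

definition slice_coord :: "quat \<Rightarrow> quat \<Rightarrow> quat \<Rightarrow> complex" where
  "slice_coord j u v = Complex (inner v u) (inner v (j * u))"

lemma Re_slice_coord [simp]: "Re (slice_coord j u v) = inner v u"
  by (simp add: slice_coord_def)

lemma bounded_linear_slice_coord: "bounded_linear (slice_coord j u)"
  unfolding linear_conv_bounded_linear[symmetric]
  by (rule linearI) (simp_all add: slice_coord_def inner_add_left complex_eq_iff)

text \<open>Left multiplication by \<open>j\<close> is skew and isometric for the inner product,
  which exchanges the two components of \<open>slice_coord\<close> with the sign of multiplication
  by \<open>\<i>\<close>.\<close>

lemma slice_coord_mult_left:
  assumes "j \<in> imag_sphere"
  shows "slice_coord j u (j * v) = \<i> * slice_coord j u v"
proof -
  have "inner (j * v) (j * u) = (norm j)\<^sup>2 * inner v u"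
    unfolding norm_quat_sq inner_quat_def times_quat.sel by algebra
  moreover have "inner (j * v) u = - inner v (j * u)"
    using assms by (simp add: inner_quat_def imag_sphere_def algebra_simps)
  ultimately show ?thesis
    using assms by (simp add: slice_coord_def imag_sphere_def complex_eq_iff)
qed

lemma slice_coord_cslice_mult:
  assumes "j \<in> imag_sphere"
  shows "slice_coord j u (cslice j c * v) = c * slice_coord j u v"
proof -
  interpret bounded_linear "slice_coord j u" by (rule bounded_linear_slice_coord)
  have "cslice j c * v = Re c *\<^sub>R v + Im c *\<^sub>R (j * v)"
    by (simp add: cslice_def scaleR_conv_of_real algebra_simps)
  then show ?thesis
    using assms by (simp add: add scaleR slice_coord_mult_left complex_eq_iff)
qed

lemma slice_coord_eqI:
  assumes "\<And>u. slice_coord j u v = slice_coord j u w"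
  shows "v = w"
proof -
  have "inner (v - w) u = 0" for u
    using arg_cong[OF assms, of Re u] by (simp add: inner_diff_left)
  then show ?thesis by (metis inner_eq_zero_iff right_minus_eq)
qed

text \<open>For \<open>w\<close> the conjugate of \<open>r\<close>, the function \<open>slice_kern w\<close> is at once \<open>\<K>(\<cdot>, r)\<close> and the reproducing
  function \<open>K\<^sub>r\<close>: the slice extension of \<open>(1 - p w)\<^sup>-\<^sup>2 / \<pi>\<close> from the slice of \<open>w\<close>.\<close>

definition slice_den :: "quat \<Rightarrow> quat \<Rightarrow> quat" where
  "slice_den w p = 1 - 2 * of_real (qRe p) * w + of_real ((norm p)\<^sup>2) * w\<^sup>2"

definition slice_num :: "quat \<Rightarrow> quat \<Rightarrow> quat" where
  "slice_num w p = 1 - 2 * qcnj p * w + (qcnj p)\<^sup>2 * w\<^sup>2"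

definition slice_kern :: "quat \<Rightarrow> quat \<Rightarrow> quat" where
  "slice_kern w p = (1 / pi) *\<^sub>R (slice_num w p * inverse (slice_den w p) ^ 2)"

section \<open>The kernel on slices and the representation formula\<close>

text \<open>\<open>slice_den\<close> depends on \<open>p\<close> only through real part and norm, so
  \<open>p\<close> may be replaced by a point of the slice of \<open>w\<close> that shares them;
  there the real quadratic splits into two conjugate-type factors. In particular \<open>p\<close>
  itself may lie in another slice.\<close>

lemma slice_den_cslice:
  assumes "j \<in> imag_sphere" "Re z = qRe p" "norm z = norm p"
  shows "slice_den (cslice j c) p = cslice j ((1 - z * c) * (1 - cnj z * c))"
proof -
  have "(1 - z * c) * (1 - cnj z * c) = 1 - 2 * of_real (qRe p) * c + of_real ((norm p)\<^sup>2) * c\<^sup>2"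
  proof -
    have "(1 - z * c) * (1 - cnj z * c) = 1 - (z + cnj z) * c + (z * cnj z) * c\<^sup>2"
      by (simp add: algebra_simps power2_eq_square)
    then show ?thesis
      using assms(2,3) by (simp add: complex_add_cnj complex_norm_square[symmetric])
  qed
  then show ?thesis
    using assms(1) by (simp only: slice_den_def cslice_add cslice_diff cslice_mult cslice_power cslice_of_real cslice_numeral cslice_1)
qed

lemma slice_num_cslice:
  assumes "j \<in> imag_sphere"
  shows "slice_num (cslice j c) (cslice j z) = cslice j ((1 - cnj z * c)\<^sup>2)"
proof -
  have "(1 - cnj z * c)\<^sup>2 = 1 - 2 * cnj z * c + (cnj z)\<^sup>2 * c\<^sup>2"
    by (simp add: algebra_simps power2_eq_square)
  then show ?thesis
    using assms by (simp only: slice_num_def cslice_add cslice_diff cslice_mult cslice_power cslice_of_real cslice_1 cslice_cnj cslice_numeral)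
qed

lemma one_minus_mult_neq_0:
  fixes z c :: "'a::real_normed_div_algebra"
  assumes "norm z < 1" "norm c < 1"
  shows "1 - z * c \<noteq> 0"
proof
  assume "1 - z * c = 0"
  then have "norm (z * c) = 1" by simp
  moreover have "norm (z * c) < 1"
    using assms mult_strict_mono'[of "norm z" 1 "norm c" 1] by (simp add: norm_mult)
  ultimately show False by simp
qed

lemma slice_den_neq_0:
  assumes "norm w < 1" "norm p < 1"
  shows "slice_den w p \<noteq> 0"
proof -
  obtain j c where j: "j \<in> imag_sphere" and w: "w = cslice j c"
    by (rule quat_in_some_slice)
  obtain i z where i: "i \<in> imag_sphere" and p: "p = cslice i z"
    by (rule quat_in_some_slice)
  have "norm c < 1" "norm z < 1"
    using assms w p norm_cslice i j by simp_all
  then have "(1 - z * c) * (1 - cnj z * c) \<noteq> 0"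
    using one_minus_mult_neq_0[of z c] one_minus_mult_neq_0[of "cnj z" c] by simp
  then show ?thesis
    using slice_den_cslice[OF j, of z p c] i by (simp add: w p qRe_cslice norm_cslice cslice_eq_0_iff[OF j])
qed

text \<open>With both points in one slice, the numerator \<open>(1 - cnj z * c)\<^sup>2\<close>
  cancels one factor of the squared denominator, and the disc kernel remains.\<close>

lemma slice_kern_cslice:
  assumes "j \<in> imag_sphere" "norm c < 1" "norm z < 1"
  shows "slice_kern (cslice j c) (cslice j z) = cslice j (inverse (of_real pi * (1 - z * c)\<^sup>2))"
proof -
  have ne: "1 - z * c \<noteq> 0" "1 - cnj z * c \<noteq> 0"
    using assms one_minus_mult_neq_0[of z c] one_minus_mult_neq_0[of "cnj z" c] by simp_all
  have "slice_kern (cslice j c) (cslice j z) =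
      cslice j ((1 / pi) *\<^sub>R ((1 - cnj z * c)\<^sup>2 * inverse ((1 - z * c) * (1 - cnj z * c)) ^ 2))"
    using assms(1) by (simp only: slice_kern_def slice_num_cslice slice_den_cslice[of j z] qRe_cslice norm_cslice
      cslice_scaleR cslice_mult cslice_power cslice_inverse)
  also have "(1 / pi) *\<^sub>R ((1 - cnj z * c)\<^sup>2 * inverse ((1 - z * c) * (1 - cnj z * c)) ^ 2) =
      inverse (of_real pi * (1 - z * c)\<^sup>2)"
  proof -
    have "(1 / pi) *\<^sub>R (b\<^sup>2 * inverse (a * b) ^ 2) = inverse (of_real pi * a\<^sup>2)" if "b \<noteq> 0" for a b :: complex
      using that by (simp add: scaleR_conv_of_real field_simps)
    then show ?thesis using ne(2) by blast
  qed
  finally show ?thesis .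
qed

text \<open>At points with the same real part and norm the denominator is the same, and the
  numerator is affine in the imaginary unit: \<open>A z + k * B z\<close>, with \<open>A\<close>
  even and \<open>B\<close> odd under conjugation of \<open>z\<close>. The unit stands on the left,
  so the formula is linear algebra in \<open>i\<close> and \<open>j\<close>.\<close>

lemma slice_kern_representation:
  assumes i: "i \<in> imag_sphere" and j: "j \<in> imag_sphere"
  shows "slice_kern w (cslice i z) =
    (1/2) *\<^sub>R ((1 - i * j) * slice_kern w (cslice j z) + (1 + i * j) * slice_kern w (cslice j (cnj z)))"
proof -
  define A where "A z = 1 - (2 * Re z) *\<^sub>R w + ((Re z)\<^sup>2 - (Im z)\<^sup>2) *\<^sub>R w\<^sup>2" for z
  define B where "B z = (2 * Im z) *\<^sub>R w - (2 * Re z * Im z) *\<^sub>R w\<^sup>2" for z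
  define V where "V = (1 / pi) *\<^sub>R inverse (slice_den w (cslice i z)) ^ 2"
  have num: "slice_num w (cslice k z) = A z + k * B z" if k: "k \<in> imag_sphere" for k z
  proof -
    have q: "qcnj (cslice k z) = Re z *\<^sub>R 1 - Im z *\<^sub>R k"
      using k by (simp add: cslice_cnj[symmetric]) (simp add: cslice_def of_real_def)
    have q2: "(Re z *\<^sub>R 1 - Im z *\<^sub>R k)\<^sup>2 = ((Re z)\<^sup>2 - (Im z)\<^sup>2) *\<^sub>R 1 - (2 * Re z * Im z) *\<^sub>R k"
      using imag_sphere_sq[OF k]
      by (simp add: power2_eq_square algebra_simps mult_2 scaleR_add_left[symmetric])
    show ?thesis
      unfolding slice_num_def q q2 A_def B_def
      by (simp add: quat_two mult.assoc algebra_simps)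
  qed
  have den: "slice_den w (cslice k z') = slice_den w (cslice i z)"
    if "k \<in> imag_sphere" "Re z' = Re z" "norm z' = norm z" for k z'
    using that i by (simp add: slice_den_def qRe_cslice norm_cslice)
  have kern: "slice_kern w (cslice k z') = (A z' + k * B z') * V"
    if "k \<in> imag_sphere" "Re z' = Re z" "norm z' = norm z" for k z'
    using that by (simp add: slice_kern_def num V_def den)
  have "j * (j * B z) = - B z"
    using imag_sphere_sq[OF j] by (simp add: mult.assoc[symmetric])
  then have "(1 - i * j) * (A z + j * B z) + (1 + i * j) * (A z - j * B z) = 2 * (A z + i * B z)"
    by (simp add: algebra_simps mult_2)
  moreover have "A (cnj z) = A z" "B (cnj z) = - B z"
    by (simp_all add: A_def B_def)
  ultimately have "(1 - i * j) * slice_kern w (cslice j z) + (1 + i * j) * slice_kern w (cslice j (cnj z)) =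
      2 * slice_kern w (cslice i z)"
    using i j by (simp add: kern mult.assoc[symmetric] distrib_right[symmetric])
  then show ?thesis by (simp add: quat_two)
qed

section \<open>Slice regular functions on the unit ball\<close>

lemma has_derivative_line:
  assumes "(f has_derivative D) (at (a + x *\<^sub>R b))"
  shows "((\<lambda>s. f (a + s *\<^sub>R b)) has_vector_derivative D b) (at x)"
proof -
  have "((\<lambda>s. a + s *\<^sub>R b) has_derivative (\<lambda>h. h *\<^sub>R b)) (at x)"
    by (auto intro!: derivative_eq_intros)
  from has_derivative_compose[OF this assms] show ?thesis
    using linear_scale[OF has_derivative_linear[OF assms]] by (simp add: has_vector_derivative_def)
qed

text \<open>The two partial derivatives are the values of the total derivative at 1 and
  \<open>i\<close>. The pointwise form frees the condition from coordinates; a real \<open>p\<close>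
  carries one condition for every \<open>i\<close>.\<close>

lemma slice_regular_iff:
  "f \<in> slice_regular \<Omega> \<longleftrightarrow> (\<forall>p\<in>\<Omega>. \<exists>D. (f has_derivative D) (at p) \<and>
     (\<forall>i\<in>imag_sphere. p \<in> slice_plane i \<longrightarrow> D 1 + i * D i = 0))"
proof -
  have *: "vector_derivative (\<lambda>s. f (of_real s + of_real y * i)) (at x) = D 1"
      "vector_derivative (\<lambda>t. f (of_real x + of_real t * i)) (at y) = D i"
    if "(f has_derivative D) (at (of_real x + of_real y * i))" for D x y i
  proof -
    have "(f has_derivative D) (at (of_real y * i + x *\<^sub>R 1))" "(f has_derivative D) (at (of_real x + y *\<^sub>R i))"
      using that by (simp_all add: scaleR_conv_of_real add.commute)
    from this[THEN has_derivative_line, THEN vector_derivative_at]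
    show "vector_derivative (\<lambda>s. f (of_real s + of_real y * i)) (at x) = D 1"
      "vector_derivative (\<lambda>t. f (of_real x + of_real t * i)) (at y) = D i"
      by (simp_all add: scaleR_conv_of_real add.commute)
  qed
  show ?thesis
  proof
    assume f: "f \<in> slice_regular \<Omega>"
    show "\<forall>p\<in>\<Omega>. \<exists>D. (f has_derivative D) (at p) \<and>
     (\<forall>i\<in>imag_sphere. p \<in> slice_plane i \<longrightarrow> D 1 + i * D i = 0)"
    proof
      fix p assume p: "p \<in> \<Omega>"
      with f obtain D where D: "(f has_derivative D) (at p)"
        by (auto simp: slice_regular_def differentiable_def)
      have "D 1 + i * D i = 0" if i: "i \<in> imag_sphere" and pi: "p \<in> slice_plane i" for i
      proof -
        obtain x y where xy: "p = of_real x + of_real y * i"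
          using pi by (auto simp: slice_plane_def)
        have "vector_derivative (\<lambda>s. f (of_real s + of_real y * i)) (at x)
            + i * vector_derivative (\<lambda>t. f (of_real x + of_real t * i)) (at y) = 0"
          using f i p unfolding xy slice_regular_def by blast
        then show ?thesis
          by (simp only: *[OF D[unfolded xy]])
      qed
      with D show "\<exists>D. (f has_derivative D) (at p) \<and>
        (\<forall>i\<in>imag_sphere. p \<in> slice_plane i \<longrightarrow> D 1 + i * D i = 0)" by blast
    qed
  next
    assume f: "\<forall>p\<in>\<Omega>. \<exists>D. (f has_derivative D) (at p) \<and>
     (\<forall>i\<in>imag_sphere. p \<in> slice_plane i \<longrightarrow> D 1 + i * D i = 0)"
    then have "\<forall>p\<in>\<Omega>. f differentiable (at p)"
      by (auto simp: differentiable_def)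
    moreover have "vector_derivative (\<lambda>s. f (of_real s + of_real y * i)) (at x)
        + i * vector_derivative (\<lambda>t. f (of_real x + of_real t * i)) (at y) = 0"
      if ixy: "i \<in> imag_sphere" "of_real x + of_real y * i \<in> \<Omega>" for i x y
    proof -
      obtain D where D: "(f has_derivative D) (at (of_real x + of_real y * i))" "D 1 + i * D i = 0"
      proof -
        have "of_real x + of_real y * i \<in> slice_plane i"
          by (auto simp: slice_plane_def)
        then show thesis using f ixy that by blast
      qed
      then show ?thesis by (simp add: *[OF D(1)])
    qed
    ultimately show "f \<in> slice_regular \<Omega>"
      by (simp add: slice_regular_def)
  qed
qed

lemma slice_regular_cong:
  assumes f: "f \<in> slice_regular \<Omega>" and "open \<Omega>" and eq: "\<And>p. p \<in> \<Omega> \<Longrightarrow> f p = g p"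
  shows "g \<in> slice_regular \<Omega>"
  unfolding slice_regular_iff
proof
  fix p assume p: "p \<in> \<Omega>"
  with f obtain D where "(f has_derivative D) (at p)"
    "\<forall>i\<in>imag_sphere. p \<in> slice_plane i \<longrightarrow> D 1 + i * D i = 0"
    unfolding slice_regular_iff by blast
  then show "\<exists>D. (g has_derivative D) (at p) \<and>
     (\<forall>i\<in>imag_sphere. p \<in> slice_plane i \<longrightarrow> D 1 + i * D i = 0)"
    using has_derivative_transform_within_open[of f D p UNIV \<Omega> g] \<open>open \<Omega>\<close> p eq by auto
qed

text \<open>The condition says \<open>D i = i * D 1\<close>, so along the slice \<open>D\<close> is
  left multiplication by slice elements applied to \<open>D 1\<close>. The coordinate turns this
  into complex multiplication.\<close>

lemma slice_regular_holomorphic: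
  assumes f: "f \<in> slice_regular (ball 0 1)" and i: "i \<in> imag_sphere"
  shows "(\<lambda>z. slice_coord i u (f (cslice i z))) holomorphic_on ball 0 1"
  unfolding holomorphic_on_open[OF open_ball]
proof
  fix z :: complex assume "z \<in> ball 0 1"
  then have p: "cslice i z \<in> ball 0 1" "cslice i z \<in> slice_plane i"
    using i by (auto simp: norm_cslice slice_plane_eq)
  then obtain D where D: "(f has_derivative D) (at (cslice i z))" and CR: "D 1 + i * D i = 0"
    using f i unfolding slice_regular_iff by blast
  interpret D: linear D using has_derivative_linear[OF D] .
  interpret sc: bounded_linear "slice_coord i u" by (rule bounded_linear_slice_coord)
  have "i * (D 1 + i * D i) = i * D 1 - D i"
    using imag_sphere_sq[OF i] by (simp add: distrib_left mult.assoc[symmetric])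
  then have Di: "D i = i * D 1" using CR by simp
  have "D (cslice i h) = cslice i h * D 1" for h
  proof -
    have "D (cslice i h) = D (Re h *\<^sub>R 1 + Im h *\<^sub>R i)"
      by (simp add: cslice_def scaleR_conv_of_real)
    also have "\<dots> = cslice i h * D 1"
      by (simp only: D.add D.scale Di) (simp add: cslice_def scaleR_conv_of_real distrib_right mult.assoc)
    finally show ?thesis .
  qed
  moreover have "((\<lambda>z. slice_coord i u (f (cslice i z))) has_derivative
      (\<lambda>h. slice_coord i u (D (cslice i h)))) (at z)"
    using D by (intro sc.has_derivative
        has_derivative_compose[OF bounded_linear.has_derivative[OF bounded_linear_cslice has_derivative_ident]])
  ultimately have "((\<lambda>z. slice_coord i u (f (cslice i z))) has_field_derivative
      slice_coord i u (D 1)) (at z)"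
    by (simp add: has_field_derivative_def slice_coord_cslice_mult[OF i] mult.commute[of _ "slice_coord i u (D 1)"])
  then show "\<exists>f'. ((\<lambda>z. slice_coord i u (f (cslice i z))) has_field_derivative f') (at z)" ..
qed

text \<open>Every slice contains the real axis, where the identity theorem is applied.\<close>

lemma slice_regular_eqI:
  assumes f: "f \<in> slice_regular (ball 0 1)" and g: "g \<in> slice_regular (ball 0 1)"
    and eq: "\<And>x. \<bar>x\<bar> < 1 \<Longrightarrow> f (of_real x) = g (of_real x)" and p: "p \<in> ball 0 1"
  shows "f p = g p"
proof -
  obtain i z where i: "i \<in> imag_sphere" and pz: "p = cslice i z"
    by (rule quat_in_some_slice)
  have z: "z \<in> ball 0 1"
    using p by (simp add: pz norm_cslice[OF i])
  have "slice_coord i u (f p) = slice_coord i u (g p)" for u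
  proof -
    let ?h = "\<lambda>z. slice_coord i u (f (cslice i z)) - slice_coord i u (g (cslice i z))"
    let ?U = "complex_of_real ` {-1<..<1}"
    have "?h z = 0"
    proof (rule analytic_continuation[of ?h "ball 0 1" ?U 0])
      show "?h holomorphic_on ball 0 1"
        by (intro holomorphic_on_diff slice_regular_holomorphic f g i)
      have "(0::real) islimpt {-1<..<1}"
        by (simp add: interior_limit_point interior_open)
      then show "0 islimpt ?U"
        using islimpt_isCont_image[of "0::real" "{-1<..<1}" complex_of_real]
        by (simp add: eventually_at_filter)
      show "?h x = 0" if "x \<in> ?U" for x
        using that eq by auto
    qed (use z in auto)
    then show ?thesis by (simp add: pz)
  qed
  then show ?thesis by (rule slice_coord_eqI)
qed

lemma mult_qcnj: "p * qcnj p = of_real ((norm p)\<^sup>2)"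
  by (simp add: quat_eq_iff norm_quat_sq) (simp add: power2_eq_square)

lemma differentiable_slice_kern:
  assumes "norm w < 1" "norm p < 1"
  shows "slice_kern w differentiable (at p)"
proof -
  have "bounded_linear (\<lambda>p. of_real (qRe p) :: quat)"
    unfolding linear_conv_bounded_linear[symmetric]
    by (rule linearI) (simp_all add: quat_eq_iff)
  then have re: "(\<lambda>p. of_real (qRe p) :: quat) differentiable (at p)"
    by (rule bounded_linear_imp_differentiable)
  have cnj: "qcnj differentiable (at p)"
    by (rule bounded_linear_imp_differentiable[OF bounded_linear_qcnj])
  have num: "slice_num w differentiable (at p)"
    unfolding slice_num_def power2_eq_square by (intro derivative_intros cnj)
  \<comment> \<open>The norm is not differentiable at 0; its square is treated as the polynomial
    \<open>p * qcnj p\<close>.\<close>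
  have "slice_den w differentiable (at p)"
    unfolding slice_den_def mult_qcnj[symmetric] power2_eq_square[of w] by (intro derivative_intros re cnj)
  then have inv: "(\<lambda>p. inverse (slice_den w p)) differentiable (at p)"
    unfolding differentiable_def using Deriv.has_derivative_inverse[where f="slice_den w", OF slice_den_neq_0[OF assms]] by blast
  show ?thesis
    unfolding slice_kern_def power2_eq_square by (intro derivative_intros num inv)
qed

text \<open>On an arbitrary slice the representation formula reduces the kernel to the holomorphic
  disc kernel \<open>g\<close> at \<open>z\<close> and at \<open>cnj z\<close>, so the
  Cauchy-Riemann condition becomes an identity between the coefficients \<open>1 - i * j\<close> and
  \<open>1 + i * j\<close>.\<close>

lemma slice_kern_regular:
  assumes "norm w < 1"
  shows "slice_kern w \<in> slice_regular (ball 0 1)"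
  unfolding slice_regular_iff
proof
  fix p :: quat assume p: "p \<in> ball 0 1"
  obtain D where D: "(slice_kern w has_derivative D) (at p)"
    using differentiable_slice_kern[OF assms] p by (auto simp: differentiable_def)
  have "D 1 + i * D i = 0" if i: "i \<in> imag_sphere" and pi: "p \<in> slice_plane i" for i
  proof -
    obtain z where pz: "p = cslice i z"
      using pi by (auto simp: slice_plane_eq)
    have z: "norm z < 1" using p by (simp add: pz norm_cslice[OF i])
    obtain j c where j: "j \<in> imag_sphere" and w: "w = cslice j c"
      by (rule quat_in_some_slice)
    have c: "norm c < 1" using assms by (simp add: w norm_cslice[OF j])
    define g where "g = (\<lambda>z. inverse (of_real pi * (1 - z * c)\<^sup>2))"
    have "\<exists>g'. (g has_field_derivative g') (at z)" if "norm z < 1" for z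
    proof -
      have "g field_differentiable (at z)"
        unfolding g_def using one_minus_mult_neq_0[OF that c]
        by (intro field_differentiable_inverse derivative_intros) auto
      then show ?thesis by (simp add: field_differentiable_def)
    qed
    then obtain a b where a: "(g has_field_derivative a) (at z)" and b: "(g has_field_derivative b) (at (cnj z))"
      using z by (metis complex_mod_cnj)
    define F where "F = (\<lambda>z. (1/2) *\<^sub>R ((1 - i * j) * cslice j (g z) + (1 + i * j) * cslice j (g (cnj z))))"
    have eq: "slice_kern w (cslice i y) = F y" if "y \<in> ball 0 1" for y
      using that slice_kern_representation[OF i j, of w y]
      by (simp add: w slice_kern_cslice[OF j c] F_def g_def del: inverse_mult_distrib)
    have "((\<lambda>y. slice_kern w (cslice i y)) has_derivative (\<lambda>h. D (cslice i h))) (at z)"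
      by (rule has_derivative_compose[OF bounded_linear.has_derivative[OF bounded_linear_cslice has_derivative_ident]])
        (use D pz in simp)
    then have "(F has_derivative (\<lambda>h. D (cslice i h))) (at z)"
      using z by (elim has_derivative_transform_within_open[where s="ball 0 1"]) (simp_all add: eq)
    moreover have "(F has_derivative (\<lambda>h. (1/2) *\<^sub>R
        ((1 - i * j) * cslice j (a * h) + (1 + i * j) * cslice j (b * cnj h)))) (at z)"
    proof -
      have "((\<lambda>z. g (cnj z)) has_derivative (\<lambda>h. b * cnj h)) (at z)"
        using has_derivative_compose[OF bounded_linear.has_derivative[OF bounded_linear_cnj has_derivative_ident]
          has_field_derivative_imp_has_derivative[OF b]] .
      then show ?thesis
        unfolding F_def
        by (intro has_derivative_scaleR_right has_derivative_add has_derivative_mult_right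
            bounded_linear.has_derivative[OF bounded_linear_cslice]
            has_field_derivative_imp_has_derivative[OF a])
    qed
    ultimately have "(\<lambda>h. D (cslice i h)) = (\<lambda>h. (1/2) *\<^sub>R
        ((1 - i * j) * cslice j (a * h) + (1 + i * j) * cslice j (b * cnj h)))"
      by (rule has_derivative_unique)
    then have *: "D (cslice i h) = (1/2) *\<^sub>R
        ((1 - i * j) * cslice j (a * h) + (1 + i * j) * cslice j (b * cnj h))" for h
      by (rule fun_cong)
    have sq: "i * (i * v) = - v" "j * (j * v) = - v" for v
      using imag_sphere_sq[OF i] imag_sphere_sq[OF j] by (simp_all add: mult.assoc[symmetric])
    have "cslice j (a * \<i>) = j * cslice j a"
      using cslice_mult[OF j, of \<i> a] by (simp only: cslice_ii mult.commute)
    moreover have "cslice j (b * cnj \<i>) = - (j * cslice j b)"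
      using cslice_mult[OF j, of \<i> b] linear_neg[OF bounded_linear.linear[OF bounded_linear_cslice], of j "\<i> * b"]
      by (simp add: mult.commute[of b])
    ultimately have "D i = (1/2) *\<^sub>R ((1 - i * j) * (j * cslice j a) - (1 + i * j) * (j * cslice j b))"
      using *[of \<i>] by (simp only: cslice_ii) simp
    moreover have "D 1 = (1/2) *\<^sub>R ((1 - i * j) * cslice j a + (1 + i * j) * cslice j b)"
      using *[of 1] by simp
    \<comment> \<open>It rests on \<open>i * (1 - i * j) * j = - (1 - i * j)\<close> and
      \<open>i * (1 + i * j) * j = 1 + i * j\<close>; the minus sign before the second term comes
      from conjugation.\<close>
    moreover have "(1 - i * j) * P + (1 + i * j) * Q + i * ((1 - i * j) * (j * P) - (1 + i * j) * (j * Q)) = 0" for P Q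
      by (simp add: algebra_simps sq)
    ultimately show ?thesis
      by (simp only: mult_scaleR_right scaleR_add_right[symmetric]) simp
  qed
  with D show "\<exists>D. (slice_kern w has_derivative D) (at p) \<and>
     (\<forall>i\<in>imag_sphere. p \<in> slice_plane i \<longrightarrow> D 1 + i * D i = 0)" by blast
qed

section \<open>Reproducing functions\<close>

lemma slice_measure_eq: "slice_measure j = distr lborel borel (cslice j)"
  unfolding slice_measure_def by (rule arg_cong[where f="distr lborel borel"]) (simp add: cslice_def fun_eq_iff)

lemma measurable_cslice [measurable]: "cslice j \<in> borel_measurable borel"
  by (intro borel_measurable_continuous_onI linear_continuous_on bounded_linear_cslice)

lemma closed_slice_plane: "closed (slice_plane j)"
  unfolding slice_plane_eq
  using linear_subspace_image[OF bounded_linear.linear[OF bounded_linear_cslice] subspace_UNIV]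
  by (rule closed_subspace)

lemma borel_measurable_slice:
  fixes g :: "quat \<Rightarrow> 'b::{second_countable_topology, real_normed_vector}"
  assumes "continuous_on (ball 0 1) g"
  shows "(\<lambda>p. indicator (slice (ball 0 1) j) p *\<^sub>R g p) \<in> borel_measurable borel"
proof (rule borel_measurable_continuous_on_indicator)
  show "slice (ball 0 1) j \<in> sets borel"
    using closed_slice_plane by (auto simp: slice_def)
  show "continuous_on (slice (ball 0 1) j) g"
    using assms by (rule continuous_on_subset) (auto simp: slice_def)
qed

lemma indicator_slice_ball:
  assumes "j \<in> imag_sphere"
  shows "indicator (slice (ball 0 1) j) (cslice j z) = (indicator (ball 0 1) z :: real)"
  using assms by (auto simp: indicator_def slice_def slice_plane_eq norm_cslice)

lemma set_integrable_slice_iff: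
  fixes g :: "quat \<Rightarrow> 'b::{banach, second_countable_topology}"
  assumes j: "j \<in> imag_sphere" and g: "continuous_on (ball 0 1) g"
  shows "set_integrable (slice_measure j) (slice (ball 0 1) j) g \<longleftrightarrow>
    set_integrable lborel (ball 0 1) (\<lambda>z. g (cslice j z))"
  unfolding set_integrable_def slice_measure_eq
  using borel_measurable_slice[OF g, of j]
  by (subst integrable_distr_eq) (simp_all add: indicator_slice_ball[OF j])

lemma set_integral_slice:
  fixes g :: "quat \<Rightarrow> 'b::{banach, second_countable_topology}"
  assumes j: "j \<in> imag_sphere" and g: "continuous_on (ball 0 1) g"
  shows "(LINT p:slice (ball 0 1) j|slice_measure j. g p) = (LINT z:ball 0 1|lborel. g (cslice j z))"
  unfolding set_lebesgue_integral_def slice_measure_eq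
  using borel_measurable_slice[OF g, of j]
  by (subst integral_distr) (simp_all add: indicator_slice_ball[OF j])

lemma slice_regular_continuous_on:
  assumes "f \<in> slice_regular \<Omega>"
  shows "continuous_on \<Omega> f"
  using assms by (intro continuous_at_imp_continuous_on ballI differentiable_imp_continuous_within)
    (auto simp: slice_regular_def)

lemma bergman_space_iff:
  assumes j: "j \<in> imag_sphere"
  shows "f \<in> bergman_space (ball 0 1) j \<longleftrightarrow> f \<in> slice_regular (ball 0 1) \<and>
    set_integrable lborel (ball 0 1) (\<lambda>z. (norm (f (cslice j z)))\<^sup>2)"
proof (cases "f \<in> slice_regular (ball 0 1)")
  case True
  then have "continuous_on (ball 0 1) (\<lambda>p. (norm (f p))\<^sup>2)"
    by (intro continuous_intros slice_regular_continuous_on)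
  from set_integrable_slice_iff[OF j this] True show ?thesis
    by (simp add: bergman_space_def)
qed (simp add: bergman_space_def)

lemma set_integrable_ball_const: "set_integrable lborel (ball (0::complex) 1) (\<lambda>_. 1 :: 'b :: {banach, real_normed_algebra_1, second_countable_topology})"
  unfolding set_integrable_def by (intro integrable_scaleR_left integrable_real_indicator)
    (use emeasure_bounded_finite[OF bounded_ball, of "0::complex" 1] in simp_all)

lemma slice_kern_bergman_space:
  assumes j: "j \<in> imag_sphere" and \<zeta>: "norm \<zeta> < 1"
  shows "slice_kern (cslice j \<zeta>) \<in> bergman_space (ball 0 1) j"
  unfolding bergman_space_iff[OF j]
proof
  show "slice_kern (cslice j \<zeta>) \<in> slice_regular (ball 0 1)"
    by (rule slice_kern_regular) (simp add: norm_cslice[OF j] \<zeta>)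
  let ?c = "cnj \<zeta>"
  have c: "norm ?c < 1" using \<zeta> by simp
  \<comment> \<open>The squared modulus of the kernel contains a fourth power, obtained by applying
    \<open>set_integrable_bergman\<close> twice to the constant 1; \<open>?c\<close> is a conjugate
    so that \<open>?c * cnj z\<close> has the modulus behaviour of
    \<open>z * \<zeta>\<close>.\<close>
  have "set_integrable lborel (ball 0 1) (\<lambda>z. 1 / (1 - ?c * cnj z)\<^sup>2 / (1 - ?c * cnj z)\<^sup>2)"
    by (intro set_integrable_bergman set_integrable_ball_const c)
  then have "set_integrable lborel (ball 0 1) (\<lambda>z. norm (1 / (1 - ?c * cnj z)\<^sup>2 / (1 - ?c * cnj z)\<^sup>2) / pi\<^sup>2)"
    by (intro set_integrable_divide set_integrable_norm)
  then show "set_integrable lborel (ball 0 1) (\<lambda>z. (norm (slice_kern (cslice j \<zeta>) (cslice j z)))\<^sup>2)"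
  proof (rule set_integrable_cong[THEN iffD1, rotated -1])
    fix z :: complex assume z: "z \<in> ball 0 1"
    have "norm (1 - ?c * cnj z) = norm (1 - z * \<zeta>)"
      by (metis complex_cnj_diff complex_cnj_mult complex_cnj_one complex_mod_cnj mult.commute)
    then show "norm (1 / (1 - ?c * cnj z)\<^sup>2 / (1 - ?c * cnj z)\<^sup>2) / pi\<^sup>2 = (norm (slice_kern (cslice j \<zeta>) (cslice j z)))\<^sup>2"
      using z by (simp add: slice_kern_cslice[OF j \<zeta>] norm_cslice[OF j] norm_divide norm_power norm_mult norm_inverse field_simps)
  qed simp_all
qed

text \<open>On a set of finite measure, L^2 lies in L^1, by \<open>t \<le> t\<^sup>2 + 1\<close>.
  Integrability of the constant 1 expresses finiteness.\<close>

lemma set_integrable_of_square: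
  fixes f :: "'a \<Rightarrow> 'b::{banach, second_countable_topology}"
  assumes "set_integrable M A (\<lambda>x. (norm (f x))\<^sup>2)" and "set_integrable M A (\<lambda>_. 1 :: real)"
    and "(\<lambda>x. indicator A x *\<^sub>R f x) \<in> borel_measurable M"
  shows "set_integrable M A f"
  unfolding set_integrable_def
proof (rule Bochner_Integration.integrable_bound)
  show "integrable M (\<lambda>x. indicator A x *\<^sub>R (norm (f x))\<^sup>2 + indicator A x *\<^sub>R (1::real))"
    using assms unfolding set_integrable_def by (intro Bochner_Integration.integrable_add)
  have "norm y \<le> (norm y)\<^sup>2 + 1" for y :: 'b
  proof -
    have "2 * norm y \<le> (norm y)\<^sup>2 + 1"
      using zero_le_power2[of "norm y - 1"] unfolding power2_diff by simp
    then show ?thesis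
      using norm_ge_zero[of y] by linarith
  qed
  then show "AE x in M. norm (indicator A x *\<^sub>R f x) \<le> norm (indicator A x *\<^sub>R (norm (f x))\<^sup>2 + indicator A x *\<^sub>R (1::real))"
    by (intro AE_I2) (auto simp: indicator_def)
qed (use assms in auto)

section \<open>The reproducing property and uniqueness\<close>

text \<open>The conjugated kernel takes values in the slice of \<open>j\<close> and multiplies from
  the left, so every coordinate of the integrand is the disc kernel times a holomorphic function, to
  which \<open>bergman_reproducing_disc\<close> applies.\<close>

theorem slice_bergman_reproducing:
  assumes j: "j \<in> imag_sphere" and f: "f \<in> bergman_space (ball 0 1) j" and \<zeta>: "norm \<zeta> < 1"
  shows "bergman_inner (ball 0 1) j (slice_kern (cslice j (cnj \<zeta>))) f = f (cslice j \<zeta>)"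
proof -
  have reg: "f \<in> slice_regular (ball 0 1)"
    and sq: "set_integrable lborel (ball 0 1) (\<lambda>z. (norm (f (cslice j z)))\<^sup>2)"
    using f by (simp_all add: bergman_space_iff[OF j])
  have contf: "continuous_on (ball 0 1) (\<lambda>z. f (cslice j z))"
    using slice_regular_continuous_on[OF reg] linear_continuous_on[OF bounded_linear_cslice]
    by (rule continuous_on_compose2) (auto simp: norm_cslice[OF j])
  have int: "set_integrable lborel (ball 0 1) (\<lambda>z. f (cslice j z))"
  proof (rule set_integrable_of_square[OF sq set_integrable_ball_const])
    show "(\<lambda>z. indicator (ball 0 1) z *\<^sub>R f (cslice j z)) \<in> borel_measurable lborel"
      using borel_measurable_continuous_on_indicator[OF _ contf] by simp
  qed
  define k where "k = (\<lambda>z. inverse (of_real pi) * inverse ((1 - \<zeta> * cnj z)\<^sup>2))"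
  define J where "J = (\<lambda>z. indicator (ball 0 1) z *\<^sub>R (cslice j (k z) * f (cslice j z)))"
  have "slice_kern (cslice j (cnj \<zeta>)) \<in> slice_regular (ball 0 1)"
    by (rule slice_kern_regular) (simp add: norm_cslice[OF j] \<zeta>)
  then have "continuous_on (ball 0 1) (\<lambda>p. qcnj (slice_kern (cslice j (cnj \<zeta>)) p) * f p)"
    by (intro continuous_intros slice_regular_continuous_on reg bounded_linear.continuous_on[OF bounded_linear_qcnj])
  from set_integral_slice[OF j this]
  have "bergman_inner (ball 0 1) j (slice_kern (cslice j (cnj \<zeta>))) f =
     (LINT z:ball 0 1|lborel. qcnj (slice_kern (cslice j (cnj \<zeta>)) (cslice j z)) * f (cslice j z))"
    by (simp add: bergman_inner_def)
  also have "\<dots> = (LINT z:ball 0 1|lborel. cslice j (k z) * f (cslice j z))"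
  proof (intro set_lebesgue_integral_cong allI impI)
    fix z :: complex assume "z \<in> ball 0 1"
    then show "qcnj (slice_kern (cslice j (cnj \<zeta>)) (cslice j z)) * f (cslice j z) = cslice j (k z) * f (cslice j z)"
      using \<zeta> by (simp add: slice_kern_cslice[OF j] cslice_cnj[OF j, symmetric] k_def mult.commute)
  qed simp
  also have "\<dots> = integral\<^sup>L lborel J"
    by (simp add: J_def set_lebesgue_integral_def)
  also have "\<dots> = f (cslice j \<zeta>)"
  proof -
    have coord: "integrable lborel (\<lambda>z. slice_coord j u (J z))"
      "(LINT z|lborel. slice_coord j u (J z)) = slice_coord j u (f (cslice j \<zeta>))" for u
    proof -
      interpret sc: bounded_linear "slice_coord j u" by (rule bounded_linear_slice_coord)
      let ?F = "\<lambda>z. slice_coord j u (f (cslice j z))"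
      have hol: "?F holomorphic_on ball 0 1"
        by (rule slice_regular_holomorphic[OF reg j])
      have intF: "set_integrable lborel (ball 0 1) ?F"
        using integrable_bounded_linear[OF bounded_linear_slice_coord int[unfolded set_integrable_def], of j u]
        by (simp add: set_integrable_def sc.scaleR)
      have eq: "slice_coord j u (J z) = inverse (of_real pi) * (indicator (ball 0 1) z *\<^sub>R (?F z / (1 - \<zeta> * cnj z)\<^sup>2))" for z
        by (simp add: J_def sc.scaleR slice_coord_cslice_mult[OF j] k_def divide_inverse mult_ac)
      show "integrable lborel (\<lambda>z. slice_coord j u (J z))"
        unfolding eq using set_integrable_bergman[OF intF \<zeta>] unfolding set_integrable_def
        by (rule integrable_mult_right)
      show "(LINT z|lborel. slice_coord j u (J z)) = slice_coord j u (f (cslice j \<zeta>))"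
        unfolding eq using bergman_reproducing_disc[OF hol intF \<zeta>]
        by (subst integral_mult_right_zero) (simp add: set_lebesgue_integral_def)
    qed
    \<comment> \<open>The real parts of the coordinates along the basis recover \<open>J\<close>;
      its integrability is needed before a coordinate can be exchanged with the integral.\<close>
    have "J = (\<lambda>z. \<Sum>b\<in>Basis. Re (slice_coord j b (J z)) *\<^sub>R b)"
      by (simp add: euclidean_representation)
    moreover have "integrable lborel (\<lambda>z. \<Sum>b\<in>Basis. Re (slice_coord j b (J z)) *\<^sub>R b)"
      by (intro Bochner_Integration.integrable_sum integrable_scaleR_left integrable_Re coord)
    ultimately have J: "integrable lborel J"
      by simp
    show ?thesis
    proof (rule slice_coord_eqI)
      fix u
      show "slice_coord j u (integral\<^sup>L lborel J) = slice_coord j u (f (cslice j \<zeta>))"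
        using integral_bounded_linear[OF bounded_linear_slice_coord J, of j u] coord(2) by simp
    qed
  qed
  finally show ?thesis .
qed

text \<open>\<open>qcnj\<close> is its own inverse, so it also commutes with the integral in the
  nonintegrable case, where both sides take the default value 0.\<close>

lemma bergman_inner_commute: "qcnj (bergman_inner \<Omega> j f g) = bergman_inner \<Omega> j g f"
proof -
  have "qcnj (bergman_inner \<Omega> j f g) =
      (LINT p|slice_measure j. qcnj (indicator (slice \<Omega> j) p *\<^sub>R (qcnj (f p) * g p)))"
    unfolding bergman_inner_def set_lebesgue_integral_def
    by (rule integral_bounded_linear'[OF bounded_linear_qcnj bounded_linear_qcnj, symmetric]) simp
  also have "\<dots> = bergman_inner \<Omega> j g f"
    unfolding bergman_inner_def set_lebesgue_integral_def
    by (simp add: linear_scale[OF bounded_linear.linear[OF bounded_linear_qcnj]] qcnj_mult)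
  finally show ?thesis .
qed

lemma bergman_inner_cong:
  assumes "\<And>p. p \<in> \<Omega> \<Longrightarrow> f p = g p"
  shows "bergman_inner \<Omega> j f h = bergman_inner \<Omega> j g h"
  unfolding bergman_inner_def set_lebesgue_integral_def
  by (rule Bochner_Integration.integral_cong) (auto simp: assms slice_def indicator_def)

lemma qcnj_slice_kern:
  assumes j: "j \<in> imag_sphere" and "norm \<zeta> < 1" "norm z < 1"
  shows "qcnj (slice_kern (cslice j (cnj z)) (cslice j \<zeta>)) = slice_kern (cslice j (cnj \<zeta>)) (cslice j z)"
  using assms by (simp add: slice_kern_cslice cslice_cnj[OF j, symmetric] mult.commute)

text \<open>For uniqueness, a candidate \<open>L\<close> is paired with the kernel \<open>?e\<close>
  at \<open>z\<close>: reproducing \<open>L\<close> by \<open>?e\<close> and \<open>?e\<close> by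
  \<open>L\<close> gives two values that are conjugate, which determines \<open>L\<close> at
  \<open>z\<close>. This covers the slice of \<open>j\<close>; \<open>slice_regular_eqI\<close> then
  needs only the real points.\<close>

theorem bergman_rep_eq:
  assumes j: "j \<in> imag_sphere" and \<zeta>: "norm \<zeta> < 1" and p: "p \<in> ball 0 1"
  shows "bergman_rep (ball 0 1) j (cslice j \<zeta>) p = slice_kern (cslice j (cnj \<zeta>)) p"
proof -
  let ?k = "slice_kern (cslice j (cnj \<zeta>))"
  let ?K = "restrict ?k (ball 0 1)"
  have k: "?k \<in> bergman_space (ball 0 1) j"
    using slice_kern_bergman_space[OF j, of "cnj \<zeta>"] \<zeta> by simp
  have "bergman_rep (ball 0 1) j (cslice j \<zeta>) = ?K"
    unfolding bergman_rep_def
  proof (rule the_equality)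
    have "?K \<in> slice_regular (ball 0 1)"
      by (rule slice_regular_cong[of ?k]) (use k in \<open>auto simp: bergman_space_def\<close>)
    moreover have "set_integrable lborel (ball 0 1) (\<lambda>z. (norm (?K (cslice j z)))\<^sup>2)"
      using k unfolding bergman_space_iff[OF j]
      by (elim conjE, subst set_integrable_cong[where f'="\<lambda>z. (norm (?k (cslice j z)))\<^sup>2"])
        (auto simp: norm_cslice[OF j])
    moreover have "f (cslice j \<zeta>) = bergman_inner (ball 0 1) j ?K f"
      if "f \<in> bergman_space (ball 0 1) j" for f
      using slice_bergman_reproducing[OF j that \<zeta>] by (subst bergman_inner_cong[where g="?k"]) simp_all
    ultimately show "?K \<in> bergman_space (ball 0 1) j \<inter> extensional (ball 0 1) \<and>
     (\<forall>f\<in>bergman_space (ball 0 1) j. f (cslice j \<zeta>) = bergman_inner (ball 0 1) j ?K f)"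
      by (simp add: bergman_space_iff[OF j])
  next
    fix L assume L: "L \<in> bergman_space (ball 0 1) j \<inter> extensional (ball 0 1) \<and>
     (\<forall>f\<in>bergman_space (ball 0 1) j. f (cslice j \<zeta>) = bergman_inner (ball 0 1) j L f)"
    have slice: "L (cslice j z) = ?k (cslice j z)" if z: "norm z < 1" for z
    proof -
      let ?e = "slice_kern (cslice j (cnj z))"
      have "L (cslice j z) = bergman_inner (ball 0 1) j ?e L"
        using slice_bergman_reproducing[OF j _ z] L by simp
      also have "\<dots> = qcnj (bergman_inner (ball 0 1) j L ?e)"
        by (simp add: bergman_inner_commute)
      also have "\<dots> = qcnj (?e (cslice j \<zeta>))"
        using L slice_kern_bergman_space[OF j, of "cnj z"] z by simp
      finally show ?thesis by (simp add: qcnj_slice_kern[OF j \<zeta> z])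
    qed
    have "L p = ?k p" if "p \<in> ball 0 1" for p
    proof (rule slice_regular_eqI[OF _ _ _ that])
      show "L \<in> slice_regular (ball 0 1)" "?k \<in> slice_regular (ball 0 1)"
        using L k by (auto simp: bergman_space_def)
      show "L (of_real x) = ?k (of_real x)" if "\<bar>x\<bar> < 1" for x
        using slice[of "of_real x"] that by simp
    qed
    then show "L = ?K"
      using L by (intro extensionalityI[of L "ball 0 1" ?K]) auto
  qed
  then show ?thesis using p by simp
qed

text \<open>\<open>slice_kern (qcnj r)\<close> mentions neither \<open>i\<close> nor
  \<open>j\<close>, so matching the defining expression for arbitrary units also proves that the
  choices do not matter.\<close>

lemma bergman_kernel2_eq:
  assumes p: "p \<in> ball 0 1" and r: "r \<in> ball 0 1"
  shows "bergman_kernel2 (ball 0 1) p r = slice_kern (qcnj r) p"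
proof -
  have half: "(1/2) * v = (1/2) *\<^sub>R v" for v :: quat
  proof -
    have "(1/2 :: quat) = of_real (1/2)" by simp
    then show ?thesis by (simp only: scaleR_conv_of_real)
  qed
  have eq: "(1/2) * (1 - i * j) * slice_kernel (ball 0 1) j (of_real x + of_real y * j) r
      + (1/2) * (1 + i * j) * slice_kernel (ball 0 1) j (of_real x - of_real y * j) r = slice_kern (qcnj r) p"
    if j: "j \<in> imag_sphere" and rj: "r \<in> slice (ball 0 1) j" and i: "i \<in> imag_sphere" and pxy: "p = of_real x + of_real y * i"
    for i j x y
  proof -
    obtain c where rc: "r = cslice j c"
      using rj by (auto simp: slice_def slice_plane_eq)
    then have c: "norm c < 1"
      using r norm_cslice[OF j] by simp
    define z where "z = Complex x y"
    have pz: "p = cslice i z" and zj: "of_real x + of_real y * j = cslice j z"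
      "of_real x - of_real y * j = cslice j (cnj z)"
      by (simp_all add: pxy z_def cslice_def)
    have z: "norm z < 1"
      using p by (simp add: pz norm_cslice[OF i])
    \<comment> \<open>Hermitian symmetry moves the parameter: the representing function of the point
      \<open>y\<close> evaluated at \<open>r\<close> becomes, after conjugation, the kernel with
      parameter \<open>qcnj r\<close> evaluated at \<open>y\<close>.\<close>
    have K: "slice_kernel (ball 0 1) j (cslice j y) r = slice_kern (qcnj r) (cslice j y)" if "norm y < 1" for y
      using bergman_rep_eq[OF j that r] qcnj_slice_kern[OF j c that]
      by (simp add: slice_kernel_def rc qcnj_slice_kern[OF j that c, symmetric] cslice_cnj[OF j])
    show ?thesis
      using slice_kern_representation[OF i j, of "qcnj r" z] z
      by (simp only: zj K complex_mod_cnj mult.assoc half mult_scaleR_left scaleR_add_right[symmetric] pz)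
  qed
  \<comment> \<open>One admissible choice is exhibited; otherwise the condition on \<open>k\<close>
    could be vacuous and uniqueness would fail.\<close>
  obtain j c where j: "j \<in> imag_sphere" and "r = cslice j c"
    by (rule quat_in_some_slice)
  then have rj: "r \<in> slice (ball 0 1) j"
    using r by (auto simp: slice_def slice_plane_eq)
  obtain i z where i: "i \<in> imag_sphere" and "p = cslice i z"
    by (rule quat_in_some_slice)
  then have pz: "p = of_real (Re z) + of_real (Im z) * i"
    by (simp add: cslice_def)
  show ?thesis
    unfolding bergman_kernel2_def
  proof (rule the_equality)
    show "\<forall>j\<in>imag_sphere. r \<in> slice (ball 0 1) j \<longrightarrow>
     (\<forall>i\<in>imag_sphere. \<forall>x y. p = of_real x + of_real y * i \<longrightarrow>
        slice_kern (qcnj r) p = (1/2) * (1 - i * j) * slice_kernel (ball 0 1) j (of_real x + of_real y * j) r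
          + (1/2) * (1 + i * j) * slice_kernel (ball 0 1) j (of_real x - of_real y * j) r)"
      using eq by metis
  next
    fix k assume "\<forall>j\<in>imag_sphere. r \<in> slice (ball 0 1) j \<longrightarrow>
     (\<forall>i\<in>imag_sphere. \<forall>x y. p = of_real x + of_real y * i \<longrightarrow>
        k = (1/2) * (1 - i * j) * slice_kernel (ball 0 1) j (of_real x + of_real y * j) r
          + (1/2) * (1 + i * j) * slice_kernel (ball 0 1) j (of_real x - of_real y * j) r)"
    then show "k = slice_kern (qcnj r) p"
      using j rj i pz eq[OF j rj i pz] by metis
  qed
qed

section \<open>The Laplacian of the kernel\<close>

text \<open>The directional derivative of \<open>slice_den w\<close> at \<open>p\<close> along
  \<open>b\<close>.\<close>

definition slice_den' :: "quat \<Rightarrow> quat \<Rightarrow> quat \<Rightarrow> quat" where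
  "slice_den' w p b = (2 * inner p b) *\<^sub>R w\<^sup>2 - (2 * qRe b) *\<^sub>R w"

text \<open>The directional derivative of \<open>slice_num w\<close>. Differentiating a square gives
  two products in opposite orders, which need not agree.\<close>

definition slice_num' :: "quat \<Rightarrow> quat \<Rightarrow> quat \<Rightarrow> quat" where
  "slice_num' w p b = (qcnj b * qcnj p + qcnj p * qcnj b) * w\<^sup>2 - 2 *\<^sub>R (qcnj b * w)"

lemma quat_of_real_mult: "of_real a * v = a *\<^sub>R v" for v :: quat
  by (simp add: scaleR_conv_of_real)

lemma qcnj_one: "qcnj 1 = 1"
  by (simp add: quat_eq_iff)

lemma qcnj_scaleR: "qcnj (a *\<^sub>R p) = a *\<^sub>R qcnj p"
  by (simp add: quat_eq_iff)

text \<open>\<open>slice_den\<close> is a real quadratic polynomial in the four coordinates, so its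
  expansion along a line is exact and the derivatives are its coefficients. The same holds for
  \<open>slice_num\<close>.\<close>

lemma slice_den_line:
  "slice_den w (p + t *\<^sub>R b) = slice_den w p + t *\<^sub>R slice_den' w p b + t\<^sup>2 *\<^sub>R ((norm b)\<^sup>2 *\<^sub>R w\<^sup>2)"
proof -
  have "(norm (p + t *\<^sub>R b))\<^sup>2 = (norm p)\<^sup>2 + t * (2 * inner p b) + t\<^sup>2 * (norm b)\<^sup>2"
    unfolding power2_norm_eq_inner
    by (simp add: inner_add_left inner_add_right inner_commute power2_eq_square algebra_simps)
  then show ?thesis
    by (simp add: slice_den_def slice_den'_def quat_of_real_mult quat_two algebra_simps del: of_real_power of_real_mult)
qed

lemma slice_den'_line: "slice_den' w (p + t *\<^sub>R b) b = slice_den' w p b + t *\<^sub>R ((2 * (norm b)\<^sup>2) *\<^sub>R w\<^sup>2)"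
  unfolding power2_norm_eq_inner
  by (simp add: slice_den'_def inner_add_left algebra_simps)

lemma slice_num_line:
  "slice_num w (p + t *\<^sub>R b) = slice_num w p + t *\<^sub>R slice_num' w p b + t\<^sup>2 *\<^sub>R ((qcnj b)\<^sup>2 * w\<^sup>2)"
proof -
  have "(qcnj (p + t *\<^sub>R b))\<^sup>2 =
      (qcnj p)\<^sup>2 + t *\<^sub>R (qcnj b * qcnj p + qcnj p * qcnj b) + t\<^sup>2 *\<^sub>R (qcnj b)\<^sup>2"
    by (simp add: qcnj_add qcnj_scaleR power2_eq_square algebra_simps)
  then show ?thesis
    by (simp add: slice_num_def slice_num'_def quat_two qcnj_add qcnj_scaleR mult.assoc
        distrib_right scaleR_add_right scaleR_diff_right mult.commute[of t 2])
qed

lemma slice_num'_line: "slice_num' w (p + t *\<^sub>R b) b = slice_num' w p b + t *\<^sub>R (2 *\<^sub>R ((qcnj b)\<^sup>2 * w\<^sup>2))"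
  by (simp add: slice_num'_def qcnj_add qcnj_scaleR power2_eq_square scaleR_2 algebra_simps)

lemma has_vector_derivative_poly2:
  fixes a b c :: "'a::real_normed_vector"
  shows "((\<lambda>t. a + t *\<^sub>R b + t\<^sup>2 *\<^sub>R c) has_vector_derivative b) (at 0)"
    and "((\<lambda>t. a + t *\<^sub>R b) has_vector_derivative b) (at 0)"
  by (auto intro!: derivative_eq_intros simp: has_vector_derivative_def)

text \<open>In general the derivative of the inverse is
  \<open>- (inverse E * E' * inverse E)\<close>; commutation at the point allows \<open>E'\<close>
  to be collected on the left, as for real functions.\<close>

lemma has_vector_derivative_inverse_power:
  fixes E :: "real \<Rightarrow> 'a::real_normed_div_algebra"
  assumes E: "(E has_vector_derivative E') (at t)" and ne: "E t \<noteq> 0" and comm: "E' * E t = E t * E'"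
  shows "((\<lambda>t. inverse (E t) ^ n) has_vector_derivative - (real n *\<^sub>R (E' * inverse (E t) ^ Suc n))) (at t)"
proof (induction n)
  case 0
  show ?case by simp
next
  case (Suc n)
  have c: "inverse (E t) * E' = E' * inverse (E t)"
    using comm[symmetric] by (rule mult_commute_imp_mult_inverse_commute)
  then have c': "inverse (E t) * (E' * v) = E' * (inverse (E t) * v)" for v
    by (metis mult.assoc)
  have "((\<lambda>t. inverse (E t)) has_vector_derivative - (E' * inverse (E t) ^ 2)) (at t)"
    unfolding has_vector_derivative_def
    by (rule has_derivative_eq_rhs[OF Deriv.has_derivative_inverse[OF ne E[unfolded has_vector_derivative_def]]])
      (simp add: c power2_eq_square mult.assoc fun_eq_iff)
  from has_vector_derivative_mult[OF this Suc]
  show ?case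
    by (simp add: algebra_simps c' power2_eq_square)
qed

text \<open>\<open>slice_den w p\<close> is a polynomial in \<open>w\<close> with real
  coefficients.\<close>

lemma slice_den_commute: "w * slice_den w p = slice_den w p * w" "w\<^sup>2 * slice_den w p = slice_den w p * w\<^sup>2"
  by (simp_all add: slice_den_def quat_two of_real_def algebra_simps power2_eq_square)

lemma inverse_slice_den_commute: "w * inverse (slice_den w p) = inverse (slice_den w p) * w"
  using mult_commute_imp_mult_inverse_commute[OF slice_den_commute(1)[symmetric]] by (rule sym)

lemma slice_den'_commute: "slice_den' w p b * slice_den w p = slice_den w p * slice_den' w p b"
  by (simp add: slice_den'_def left_diff_distrib right_diff_distrib slice_den_commute)

text \<open>\<open>b\<close> precedes \<open>p\<close>, so that \<open>slice_kern' w b\<close> is a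
  function of the point, ready to be differentiated along \<open>b\<close> again.\<close>

definition slice_kern' :: "quat \<Rightarrow> quat \<Rightarrow> quat \<Rightarrow> quat" where
  "slice_kern' w b p = (1 / pi) *\<^sub>R (slice_num' w p b * inverse (slice_den w p) ^ 2
     - 2 *\<^sub>R (slice_num w p * slice_den' w p b * inverse (slice_den w p) ^ 3))"

text \<open>The second derivative of P S^-2: the 4 before \<open>slice_num'\<close> counts two equal
  mixed terms with factor 2, \<open>4 * (norm b)\<^sup>2\<close> is 2 times the second derivative of
  S, and 6 is 2 times 3 from the power -2.\<close>

definition slice_kern'' :: "quat \<Rightarrow> quat \<Rightarrow> quat \<Rightarrow> quat" where
  "slice_kern'' w b p = (1 / pi) *\<^sub>R (2 *\<^sub>R ((qcnj b)\<^sup>2 * w\<^sup>2) * inverse (slice_den w p) ^ 2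
     - 4 *\<^sub>R (slice_num' w p b * slice_den' w p b * inverse (slice_den w p) ^ 3)
     - (4 * (norm b)\<^sup>2) *\<^sub>R (slice_num w p * w\<^sup>2 * inverse (slice_den w p) ^ 3)
     + 6 *\<^sub>R (slice_num w p * slice_den' w p b * slice_den' w p b * inverse (slice_den w p) ^ 4))"

lemma has_vector_derivative_slice_parts:
  "((\<lambda>t. slice_num w (p + t *\<^sub>R b)) has_vector_derivative slice_num' w p b) (at 0)"
  "((\<lambda>t. slice_num' w (p + t *\<^sub>R b) b) has_vector_derivative 2 *\<^sub>R ((qcnj b)\<^sup>2 * w\<^sup>2)) (at 0)"
  "((\<lambda>t. slice_den' w (p + t *\<^sub>R b) b) has_vector_derivative (2 * (norm b)\<^sup>2) *\<^sub>R w\<^sup>2) (at 0)"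
  "((\<lambda>t. slice_den w (p + t *\<^sub>R b)) has_vector_derivative slice_den' w p b) (at 0)"
  unfolding slice_num_line slice_num'_line slice_den_line slice_den'_line
  by (rule has_vector_derivative_poly2)+

lemma has_vector_derivative_slice_den_power:
  assumes "norm w < 1" "norm p < 1"
  shows "((\<lambda>t. inverse (slice_den w (p + t *\<^sub>R b)) ^ n) has_vector_derivative
    - (real n *\<^sub>R (slice_den' w p b * inverse (slice_den w p) ^ Suc n))) (at 0)"
  using has_vector_derivative_inverse_power[OF has_vector_derivative_slice_parts(4), of w p b n]
    slice_den_neq_0[OF assms] slice_den'_commute[of w p b]
  by simp

lemma has_vector_derivative_slice_kern:
  assumes "norm w < 1" "norm p < 1"
  shows "((\<lambda>t. slice_kern w (p + t *\<^sub>R b)) has_vector_derivative slice_kern' w b p) (at 0)"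
  unfolding slice_kern_def
  by (rule has_vector_derivative_eq_rhs[OF bounded_linear.has_vector_derivative[OF bounded_linear_scaleR_right
        has_vector_derivative_mult[OF has_vector_derivative_slice_parts(1) has_vector_derivative_slice_den_power[OF assms]]]])
    (simp add: slice_kern'_def mult.assoc numeral_3_eq_3[symmetric])

lemma has_vector_derivative_slice_kern':
  assumes "norm w < 1" "norm p < 1"
  shows "((\<lambda>t. slice_kern' w b (p + t *\<^sub>R b)) has_vector_derivative slice_kern'' w b p) (at 0)"
  unfolding slice_kern'_def
  by (rule has_vector_derivative_eq_rhs[OF bounded_linear.has_vector_derivative[OF bounded_linear_scaleR_right
        has_vector_derivative_diff[OF
          has_vector_derivative_mult[OF has_vector_derivative_slice_parts(2) has_vector_derivative_slice_den_power[OF assms]]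
          bounded_linear.has_vector_derivative[OF bounded_linear_scaleR_right
            has_vector_derivative_mult[OF
              has_vector_derivative_mult[OF has_vector_derivative_slice_parts(1) has_vector_derivative_slice_parts(3)]
              has_vector_derivative_slice_den_power[OF assms]]]]]])
    (simp add: slice_kern''_def algebra_simps, simp flip: scaleR_add_left)

text \<open>A formula valid on an open set may be substituted before differentiating, because the
  line stays in that set for small \<open>t\<close>.\<close>

lemma partial_deriv_eqI:
  assumes "open A" "q \<in> A" and eq: "\<And>p. p \<in> A \<Longrightarrow> f p = g p"
    and g: "((\<lambda>t. g (q + t *\<^sub>R b)) has_vector_derivative D) (at 0)"
  shows "partial_deriv b f q = D"
proof -
  have "open ((\<lambda>t. q + t *\<^sub>R b) -` A)"
    using \<open>open A\<close> by (intro continuous_open_vimage continuous_intros)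
  then have "((\<lambda>t. f (q + t *\<^sub>R b)) has_vector_derivative D) (at 0)"
    using assms by (intro has_vector_derivative_transform_within_open[OF g]) auto
  then show ?thesis
    unfolding partial_deriv_def by (rule vector_derivative_at)
qed

text \<open>The gradient of \<open>slice_den w\<close> involves only the vectors \<open>1\<close> and \<open>p\<close>, so contracting with it
  evaluates a linear \<open>T\<close> there.\<close>

lemma sum_Basis_mult_slice_den':
  assumes "linear T"
  shows "(\<Sum>b\<in>Basis. T b * slice_den' w p b) = 2 *\<^sub>R (T p * w\<^sup>2) - 2 *\<^sub>R (T 1 * w)"
proof -
  have re: "qRe b = inner 1 b" for b
    by (simp add: inner_quat_def)
  have T: "(\<Sum>b\<in>Basis. inner v b *\<^sub>R T b) = T v" for v
    using linear_sum[OF assms, of "\<lambda>b. inner v b *\<^sub>R b" Basis] euclidean_representation[of v]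
    by (simp add: linear_scale[OF assms])
  have "(\<Sum>b\<in>Basis. T b * slice_den' w p b) =
      (\<Sum>b\<in>Basis. 2 *\<^sub>R ((inner p b *\<^sub>R T b) * w\<^sup>2) - 2 *\<^sub>R ((inner 1 b *\<^sub>R T b) * w))"
    by (simp add: slice_den'_def re right_diff_distrib)
  also have "\<dots> = 2 *\<^sub>R ((\<Sum>b\<in>Basis. inner p b *\<^sub>R T b) * w\<^sup>2) - 2 *\<^sub>R ((\<Sum>b\<in>Basis. inner 1 b *\<^sub>R T b) * w)"
    by (simp add: sum_subtractf sum_distrib_right scaleR_sum_right)
  finally show ?thesis by (simp only: T)
qed

section \<open>Contractions over the basis and the Laplacian\<close>

text \<open>Evaluating \<open>slice_num' w p\<close> at \<open>p\<close> and at 1 yields four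
  monomials, which are those of P multiplied by 4 w^2.\<close>

lemma sum_Basis_num'_den':
  "(\<Sum>b\<in>Basis. slice_num' w p b * slice_den' w p b) = 4 *\<^sub>R (slice_num w p * w\<^sup>2)"
proof -
  have lin: "linear (slice_num' w p)"
    by (rule linearI) (simp_all add: slice_num'_def qcnj_add qcnj_scaleR algebra_simps)
  have 1: "slice_num' w p p = 2 *\<^sub>R ((qcnj p)\<^sup>2 * w\<^sup>2) - 2 *\<^sub>R (qcnj p * w)"
    "slice_num' w p 1 = 2 *\<^sub>R (qcnj p * w\<^sup>2) - 2 *\<^sub>R w"
    by (simp_all add: slice_num'_def qcnj_one power2_eq_square scaleR_2 algebra_simps)
  have 2: "slice_num w p = 1 - qcnj p * w - qcnj p * w + (qcnj p)\<^sup>2 * w\<^sup>2"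
    by (simp add: slice_num_def mult_2 algebra_simps)
  show ?thesis
    unfolding sum_Basis_mult_slice_den'[OF lin] 1 2 by (simp add: algebra_simps power2_eq_square)
qed

lemma sum_Basis_den'_den':
  "(\<Sum>b\<in>Basis. slice_den' w p b * slice_den' w p b) = 4 *\<^sub>R (w\<^sup>2 * slice_den w p)"
proof -
  have lin: "linear (slice_den' w p)"
    by (rule linearI) (simp_all add: slice_den'_def inner_add_right algebra_simps)
  have 1: "slice_den' w p p = (2 * (norm p)\<^sup>2) *\<^sub>R w\<^sup>2 - (2 * qRe p) *\<^sub>R w"
    "slice_den' w p 1 = (2 * qRe p) *\<^sub>R w\<^sup>2 - 2 *\<^sub>R w"
    by (simp_all add: slice_den'_def power2_norm_eq_inner) (simp add: inner_quat_def)
  have 2: "slice_den w p = 1 - qRe p *\<^sub>R w - qRe p *\<^sub>R w + (norm p)\<^sup>2 *\<^sub>R w\<^sup>2"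
    by (simp add: slice_den_def mult_2 quat_of_real_mult algebra_simps del: of_real_power)
  show ?thesis
    unfolding sum_Basis_mult_slice_den'[OF lin] 1 2 by (simp add: algebra_simps power2_eq_square)
qed

text \<open>One real and three imaginary units give 1 - 3 = -2. The dimension four enters here,
  through Delta P = 2 (-2) w^2 and Delta S = 2 (4) w^2.\<close>

lemma sum_Basis_qcnj_sq: "(\<Sum>b\<in>Basis. (qcnj b)\<^sup>2) = -2" "(\<Sum>b\<in>Basis. (norm (b :: quat))\<^sup>2) = 4"
  by (simp_all add: Basis_quat_def quat_eq_iff power2_eq_square norm_quat_def inner_quat_def)

lemma sum_Basis_slice_kern'':
  assumes "norm w < 1" "norm p < 1"
  shows "(\<Sum>b\<in>Basis. slice_kern'' w b p) =
    - (4 / pi) *\<^sub>R ((inverse (slice_den w p) ^ 2 + 2 * slice_num w p * inverse (slice_den w p) ^ 3) * w\<^sup>2)"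
proof -
  let ?V = "inverse (slice_den w p)"
  let ?P = "slice_num w p"
  \<comment> \<open>Needed to bring w^2 to the far right, where the final formula has it.\<close>
  have Vw: "?V ^ n * w\<^sup>2 = w\<^sup>2 * ?V ^ n" for n
  proof -
    have "?V * w\<^sup>2 = w\<^sup>2 * ?V"
      by (simp add: power2_eq_square mult.assoc inverse_slice_den_commute[symmetric])
        (simp add: mult.assoc[symmetric] inverse_slice_den_commute)
    then show ?thesis by (simp add: power_commuting_commutes)
  qed
  have SV: "slice_den w p * ?V ^ 4 = ?V ^ 3"
  proof -
    have "slice_den w p * ?V ^ 4 = slice_den w p * ?V * ?V ^ 3"
      by (simp add: mult.assoc power_Suc[symmetric])
    then show ?thesis using slice_den_neq_0[OF assms] by simp
  qed
  have "(\<Sum>b\<in>Basis. slice_kern'' w b p) = (1 / pi) *\<^sub>R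
     (2 *\<^sub>R ((\<Sum>b\<in>Basis. (qcnj b)\<^sup>2) * w\<^sup>2 * ?V ^ 2)
     - 4 *\<^sub>R ((\<Sum>b\<in>Basis. slice_num' w p b * slice_den' w p b) * ?V ^ 3)
     - (4 * (\<Sum>b\<in>Basis. (norm (b :: quat))\<^sup>2)) *\<^sub>R (?P * w\<^sup>2 * ?V ^ 3)
     + 6 *\<^sub>R (?P * (\<Sum>b\<in>Basis. slice_den' w p b * slice_den' w p b) * ?V ^ 4))"
    by (simp add: slice_kern''_def sum.distrib sum_subtractf sum_distrib_left sum_distrib_right
        scaleR_sum_right scaleR_sum_left scaleR_right_distrib scaleR_right_diff_distrib mult.assoc
        del: norm_Basis)
  also have "\<dots> = (1 / pi) *\<^sub>R (- 4 *\<^sub>R (w\<^sup>2 * ?V ^ 2) - 8 *\<^sub>R (?P * w\<^sup>2 * ?V ^ 3))"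
  proof -
    have "(- 2 :: quat) * w\<^sup>2 * ?V ^ 2 = - 2 *\<^sub>R (w\<^sup>2 * ?V ^ 2)"
      by (simp add: quat_two mult.assoc)
    moreover have "4 *\<^sub>R (?P * w\<^sup>2) * ?V ^ 3 = 4 *\<^sub>R (?P * w\<^sup>2 * ?V ^ 3)"
      by simp
    moreover have "?P * (4 *\<^sub>R (w\<^sup>2 * slice_den w p)) * ?V ^ 4 = 4 *\<^sub>R (?P * w\<^sup>2 * ?V ^ 3)"
      by (simp only: mult_scaleR_left mult_scaleR_right mult.assoc SV)
    \<comment> \<open>The multiples of \<open>X\<close>, which stands for P w^2 S^-3, are -16 from
      the mixed gradients, -16 from Delta S and +24 from |grad S|^2, where S has cancelled one
      inverse power; the sum is -8.\<close>
    moreover have "2 *\<^sub>R (- 2 *\<^sub>R Y) - 4 *\<^sub>R (4 *\<^sub>R X) - (4 * 4) *\<^sub>R X + 6 *\<^sub>R (4 *\<^sub>R X) =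
        - 4 *\<^sub>R Y - 8 *\<^sub>R X" for X Y :: quat
      by (simp add: quat_eq_iff)
    ultimately show ?thesis
      unfolding sum_Basis_qcnj_sq sum_Basis_num'_den' sum_Basis_den'_den' by (simp only:)
  qed
  also have "\<dots> = - (4 / pi) *\<^sub>R ((?V ^ 2 + 2 * ?P * ?V ^ 3) * w\<^sup>2)"
    by (simp add: quat_two distrib_right mult.assoc Vw scaleR_add_right scaleR_diff_right)
  finally show ?thesis .
qed

theorem theorem6p2:
  fixes q r :: quat
  assumes "q \<in> ball 0 1" and "r \<in> ball 0 1"
  shows "laplacian (\<lambda>p. bergman_kernel2 (ball 0 1) p r) q =
    (- (4 / pi)) *\<^sub>R
      (((1 - 2 * of_real (qRe q) * qcnj r + of_real ((norm q)\<^sup>2) * (qcnj r)\<^sup>2) powi (-2)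
        + 2 * (1 - 2 * qcnj q * qcnj r + (qcnj q)\<^sup>2 * (qcnj r)\<^sup>2)
            * (1 - 2 * of_real (qRe q) * qcnj r + of_real ((norm q)\<^sup>2) * (qcnj r)\<^sup>2) powi (-3))
       * (qcnj r)\<^sup>2)"
proof -
  let ?w = "qcnj r"
  have w: "norm ?w < 1"
    using assms(2) by simp
  \<comment> \<open>Stated on the whole ball and not only at \<open>q\<close>, since the second
    partial derivative needs the first one near \<open>q\<close>.\<close>
  have 1: "partial_deriv b (\<lambda>p. bergman_kernel2 (ball 0 1) p r) p = slice_kern' ?w b p"
    if "p \<in> ball 0 1" for b p
    using that w
    by (intro partial_deriv_eqI[OF open_ball that, where g="slice_kern ?w"] bergman_kernel2_eq
        has_vector_derivative_slice_kern assms(2)) simp_all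
  have 2: "partial_deriv b (partial_deriv b (\<lambda>p. bergman_kernel2 (ball 0 1) p r)) q = slice_kern'' ?w b q" for b
    using assms(1) w
    by (intro partial_deriv_eqI[OF open_ball assms(1), where g="slice_kern' ?w b"] 1
        has_vector_derivative_slice_kern') simp_all
  have "laplacian (\<lambda>p. bergman_kernel2 (ball 0 1) p r) q =
      - (4 / pi) *\<^sub>R ((inverse (slice_den ?w q) ^ 2 + 2 * slice_num ?w q * inverse (slice_den ?w q) ^ 3) * ?w\<^sup>2)"
    using sum_Basis_slice_kern''[OF w, of q] assms(1) by (simp add: laplacian_def 2)
  then show ?thesis
    by (simp add: slice_den_def slice_num_def power_int_minus power_inverse)
qed

end
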